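(* Let $I:=[T_0,T]$ with $-\infty<T_0<T<+\infty$, and let $\rho\colon I\to\mathbb R$ be a nonnegative absolutely continuous function. Let $\varepsilon,K_1,K_2,K_3,K_4\colon I\to\mathbb R_+$ be nonnegative measurable functions such that $$ t\mapsto\varepsilon(t),\quad t\mapsto K_1(t),\quad t\mapsto K_2(t)\quad\text{and}\quad t\mapsto K_3(t)\int_{T_0}^tK_4(s)\,ds $$ are integrable on $I$. Suppose that for a.e. $t\in I$ $$ \dot\rho(t)\le\varepsilon(t)+K_1(t)\sqrt{\rho(t)}+K_2(t)\rho(t)+K_3(t)\sqrt{\rho(t)}\int_{T_0}^tK_4(s)\sqrt{\rho(s)}\,ds . $$ Set $\gamma(t):=K_2(t)+K_3(t)\int_{T_0}^tK_4(s)\,ds$. Then: (a) For all $t\in I$, $$ \rho(t)\le\rho(T_0)\exp\Big(\int_{T_0}^t(\gamma(s)+K_1(s))\,ds\Big)+\int_{T_0}^t(\varepsilon(s)+K_1(s))\exp\Big(\int_s^t(\gamma(\tau)+K_1(\tau))\,d\tau\Big)ds . $$ (b) If, in addition, $\varepsilon\equiv0$, then for all $t\in I$, $$ \sqrt{\rho(t)}\le\sqrt{\rho(T_0)}\exp\Big(\frac12\int_{T_0}^t\gamma(s)\,ds\Big)+\frac12\int_{T_0}^tK_1(s)\exp\Big(\frac12\int_s^t\gamma(\tau)\,d\tau\Big)ds . $$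
   Context: $\mathbb R_+=[0,+\infty[$. Integrals of nonnegative measurable functions are Lebesgue integrals with values in $[0,+\infty]$, with the convention $0\cdot\infty=0$. *)

theory Defs
  imports "HOL-Analysis.Analysis"
begin

text \<open>
  Absolute continuity of a real function on a compact interval (unrelated to the
  library's absolute continuity of measures).
\<close>

definition abs_continuous_on_Icc :: "real \<Rightarrow> real \<Rightarrow> (real \<Rightarrow> real) \<Rightarrow> bool" where
  "abs_continuous_on_Icc a b f \<longleftrightarrow>
    (\<forall>e>0. \<exists>d>0. \<forall>n (u :: nat \<Rightarrow> real) v.
      (\<forall>i<n. a \<le> u i \<and> u i \<le> v i \<and> v i \<le> b) \<and>
      disjoint_family_on (\<lambda>i. {u i<..<v i}) {..<n} \<and>
      (\<Sum>i<n. v i - u i) < d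
      \<longrightarrow> (\<Sum>i<n. \<bar>f (v i) - f (u i)\<bar>) < e)"

text \<open>
  The exponential on \<open>[0, \<infinity>]\<close>, with \<open>exp \<infinity> = \<infinity>\<close>; it makes it possible to apply
  \<open>exp\<close> to an integral with values in \<open>[0, \<infinity>]\<close> without a junk value.
\<close>

definition exp_ennreal :: "ennreal \<Rightarrow> ennreal" where
  "exp_ennreal x = (if x = \<infinity> then \<infinity> else ennreal (exp (enn2real x)))"

end

theory Submission
  imports Defs
begin

text \<open>
  With the running maximum \<open>m(t) = max {\<rho>(s) | T\<^sub>0 \<le> s \<le> t}\<close> the nonlocal term is at most
  \<open>K\<^sub>3 m \<integral> K\<^sub>4\<close>, so integrating the differential inequality gives
  \<open>m(t) \<le> \<rho>(T\<^sub>0) + \<integral> (\<epsilon> + K\<^sub>1 \<surd>m + \<gamma> m)\<close>. Part (a) is the integral form of Gronwall's lemma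
  after \<open>\<surd>m \<le> 1 + m\<close>; part (b) is Gronwall's lemma for the square root of the right-hand side,
  made positive by adding a small constant to \<open>\<rho>(T\<^sub>0)\<close>.

  Both Gronwall lemmas are obtained by estimating increments over short intervals and summing, so
  that no indefinite integral has to be differentiated. Integrating the differential inequality
  needs that an absolutely continuous function is differentiable almost everywhere (by Vitali
  coverings) and that its increments are bounded by the integral of a bound on the derivative (by
  fine tagged divisions).
\<close>

subsection \<open>Vitali coverings by intervals\<close>

text \<open>The nonlocal term sees all of \<open>\<rho>\<close> on \<open>{T0..t}\<close>, so a
  Gronwall argument for \<open>\<rho>\<close> itself does not close. The running maximum controls
  the past by a present value, and it inherits the integrated inequality because the right-hand side
  of that inequality is nondecreasing in \<open>t\<close>. Absolute continuity is decisive in the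
  integration: a bound on the derivative almost everywhere says nothing about the increments of a
  Cantor type function. Differentiability almost everywhere is needed as well, because
  \<open>deriv \<rho>\<close> carries information only where \<open>\<rho>\<close> is
  differentiable. The coefficients are merely integrable and may be unbounded, so errors of
  increments over short intervals cannot be measured uniformly by \<open>v - u\<close>. They are
  charged to the increment of a fixed function, such as an indefinite integral, and then telescope.
  The integral of \<open>K4\<close> may be infinite where \<open>K3\<close> vanishes, so the
  real-valued analysis works with a finite version of \<open>\<gamma>\<close> that agrees with it
  almost everywhere.\<close>

lemma Vitali_finite_intervals:
  fixes E :: "real set"
  assumes "open O'" "O' \<in> lmeasurable" "E \<subseteq> O'" and eta: "0 < \<eta>"
    and fine: "\<And>x d. \<lbrakk>x \<in> E; 0 < d\<rbrakk> \<Longrightarrow> \<exists>u v. u \<le> x \<and> x \<le> v \<and> u < v \<and> v - u < d \<and> P u v"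
  obtains D R where "finite D" "\<And>K. K \<in> D \<Longrightarrow> \<exists>u v. u < v \<and> K = {u..v} \<and> P u v"
    "\<Union>D \<subseteq> O'" "pairwise disjnt D" "R \<in> lmeasurable" "measure lebesgue R < \<eta>" "E \<subseteq> \<Union>D \<union> R"
proof -
  define I where "I = {(u,v). u < v \<and> P u v \<and> {u..v} \<subseteq> O'}"
  \<comment> \<open>Intervals become closed balls with centre \<open>a\<close> and radius
    \<open>r\<close>, the form in which the covering theorem is stated.\<close>
  define a where "a = (\<lambda>(u::real,v). (u+v)/2)"
  define r where "r = (\<lambda>(u::real,v). (v-u)/2)"
  have cb: "cball (a i) (r i) = {fst i..snd i}" for i
    by (auto simp: a_def r_def cball_eq_atLeastAtMost case_prod_beta field_simps)
  obtain C where C: "countable C" "C \<subseteq> I"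
    and dis: "pairwise (\<lambda>i j. disjnt (cball (a i) (r i)) (cball (a j) (r j))) C"
    and neg: "negligible (E - (\<Union>i\<in>C. cball (a i) (r i)))"
  proof (rule Vitali_covering_theorem_cballs[of I r E a])
    show "0 < r i" if "i \<in> I" for i using that by (auto simp: I_def r_def)
    fix x d :: real assume "x \<in> E" "0 < d"
    obtain e where e: "e > 0" "ball x e \<subseteq> O'"
      using \<open>x \<in> E\<close> assms(1,3) by (meson openE subsetD)
    obtain u v where uv: "u \<le> x" "x \<le> v" "u < v" "v - u < min e d" "P u v"
      using fine[OF \<open>x \<in> E\<close>, of "min e d"] e \<open>d > 0\<close> by auto
    have "{u..v} \<subseteq> O'"
      using uv e(2) by (intro order_trans[OF _ e(2)]) (auto simp: dist_real_def)
    then show "\<exists>i. i \<in> I \<and> x \<in> cball (a i) (r i) \<and> r i < d"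
      using uv cb[of "(u,v)"] by (intro exI[of _ "(u,v)"]) (auto simp: I_def r_def simp del: mem_cball)
  qed auto
  define S where "S = (\<lambda>i::real\<times>real. {fst i..snd i}) ` C"
  have "countable S" using C by (simp add: S_def)
  have "pairwise disjnt S" using dis unfolding cb S_def pairwise_def by auto
  have CI: "fst i < snd i \<and> P (fst i) (snd i) \<and> {fst i..snd i} \<subseteq> O'" if "i \<in> C" for i
  proof -
    have "(fst i, snd i) \<in> I" using that C(2) by auto
    then show ?thesis unfolding I_def by blast
  qed
  have SO: "\<Union>S \<subseteq> O'" using CI unfolding S_def by blast
  have SP: "\<exists>u v. u < v \<and> K = {u..v} \<and> P u v" if "K \<in> S" for K
    using that CI unfolding S_def by blast
  have negS: "negligible (E - \<Union>S)" using neg by (simp add: cb S_def)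
  have Sm: "K \<in> lmeasurable" if "K \<in> S" for K using SP[OF that] by auto
  have Ul: "\<Union>S \<in> lmeasurable"
  proof (rule fmeasurableI2[OF assms(2) SO])
    show "\<Union>S \<in> sets lebesgue" using Sm \<open>countable S\<close> by (intro sets.countable_Union) auto
  qed
  have "measure lebesgue (\<Union>D) \<le> measure lebesgue (\<Union>S)" if "D \<subseteq> S" "finite D" for D
    using that Sm Ul by (intro measure_mono_fmeasurable) (auto intro!: sets.finite_Union)
  \<comment> \<open>The countable disjoint family has finite total measure, so finitely many members
    exhaust it up to \<open>\<eta>\<close>.\<close>
  then obtain D where DS: "D \<subseteq> S" and fD: "finite D"
    and n: "measure lebesgue (\<Union>S) - \<eta> < measure lebesgue (\<Union>D)"
    using measure_countable_Union_approachable[OF \<open>countable S\<close> eta Sm] by blast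
  have Dl: "\<Union>D \<in> lmeasurable" using DS Sm fD by (intro fmeasurable.finite_Union) auto
  \<comment> \<open>What \<open>D\<close> misses of \<open>E\<close> lies in the tail of the
    countable family, of measure below \<open>\<eta>\<close>, or in the null set missed by the whole
    family.\<close>
  define R where "R = (\<Union>S - \<Union>D) \<union> (E - \<Union>S)"
  have Rl: "R \<in> lmeasurable" unfolding R_def
    using fmeasurable_Diff[OF Ul, of "\<Union>D"] Dl negS
    by (intro fmeasurable.Un) (auto simp: negligible_iff_measure)
  have "measure lebesgue R \<le> measure lebesgue (\<Union>S - \<Union>D) + measure lebesgue (E - \<Union>S)"
    unfolding R_def using Ul Dl negS
    by (intro measure_Un_le) (auto simp: negligible_iff_measure fmeasurable_def)
  also have "\<dots> = measure lebesgue (\<Union>S) - measure lebesgue (\<Union>D)"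
    using negS measurable_measure_Diff[of "\<Union>S" lebesgue "\<Union>D"] Ul Dl DS
    by (auto simp: negligible_iff_measure)
  also have "\<dots> < \<eta>" using n by simp
  finally have mR: "measure lebesgue R < \<eta>" .
  show thesis
  proof (rule that[OF fD _ _ _ Rl mR])
    show "\<exists>u v. u < v \<and> K = {u..v} \<and> P u v" if "K \<in> D" for K using SP that DS by auto
    show "\<Union>D \<subseteq> O'" using DS SO by auto
    show "pairwise disjnt D" using \<open>pairwise disjnt S\<close> DS by (rule pairwise_subset)
    show "E \<subseteq> \<Union>D \<union> R" by (auto simp: R_def)
  qed
qed

section \<open>Divisions and finite families of disjoint intervals\<close>

text \<open>Tagging each interval of the division by its left endpoint reduces this to telescoping
  over a tagged division; the tags do not enter the sum.\<close>

lemma sum_division_1: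
  fixes f :: "real \<Rightarrow> 'a::real_normed_vector"
  assumes "a \<le> b" "q division_of {a..b}"
  shows "(\<Sum>K\<in>q. f (Sup K) - f (Inf K)) = f b - f a"
proof -
  have K: "K \<subseteq> {a..b}" "\<exists>c d. c \<le> d \<and> K = {c..d}" if "K \<in> q" for K
    using division_ofD(2,3,4)[OF assms(2) that] by (auto simp: box_real atLeastatMost_empty_iff2) (metis order_trans)
  define p where "p = (\<lambda>K. (Inf K, K)) ` q"
  have "p tagged_division_of {a..b}"
  proof (rule tagged_division_ofI)
    show "finite p" using assms(2) by (auto simp: p_def)
    fix x L assume "(x, L) \<in> p"
    then have L: "L \<in> q" "x = Inf L" by (auto simp: p_def)
    with K(2) obtain c d where cd: "c \<le> d" "L = {c..d}" by blast
    show "x \<in> L" using cd L by simp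
    show "L \<subseteq> {a..b}" using K L by blast
    show "\<exists>a b. L = cbox a b" using cd by (metis box_real(2))
    fix x' L' assume "(x', L') \<in> p" "(x, L) \<noteq> (x', L')"
    then show "interior L \<inter> interior L' = {}"
      using L division_ofD(5)[OF assms(2)] by (auto simp: p_def)
  next
    have "{K. \<exists>x. (x, K) \<in> p} = q" by (auto simp: p_def)
    then show "\<Union> {K. \<exists>x. (x, K) \<in> p} = {a..b}"
      using division_ofD(6)[OF assms(2)] by simp
  qed
  then have "(\<Sum>(x,K)\<in>p. f (Sup K) - f (Inf K)) = f b - f a"
    by (rule additive_tagged_division_1[OF assms(1)])
  moreover have "(\<Sum>(x,K)\<in>p. f (Sup K) - f (Inf K)) = (\<Sum>K\<in>q. f (Sup K) - f (Inf K))"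
    unfolding p_def by (subst sum.reindex) (auto simp: inj_on_def)
  ultimately show ?thesis by simp
qed

text \<open>Nondegenerate, so that \<open>Inf K\<close> and \<open>Sup K\<close> recover the
  endpoints and the sets themselves can index sums; disjoint as sets, so that the lengths add up to
  the measure of the union.\<close>

definition disjoint_intervals :: "real set set \<Rightarrow> bool" where
  "disjoint_intervals D \<longleftrightarrow> finite D \<and> pairwise disjnt D \<and> (\<forall>K\<in>D. \<exists>u v. u < v \<and> K = {u..v})"

lemma disjoint_intervalsD:
  assumes "disjoint_intervals D" "K \<in> D"
  shows "Inf K < Sup K" "K = {Inf K..Sup K}"
  using assms by (auto simp: disjoint_intervals_def)

lemma disjoint_intervalsE:
  assumes "K \<in> D" "disjoint_intervals D"
  obtains u v where "u < v" "K = {u..v}"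
  by (rule that[OF disjoint_intervalsD[OF assms(2,1)]])

lemma disjoint_intervals_measure:
  assumes "disjoint_intervals D"
  shows "\<Union>D \<in> lmeasurable" "measure lebesgue (\<Union>D) = (\<Sum>K\<in>D. Sup K - Inf K)"
proof -
  have D: "K \<in> lmeasurable" "measure lebesgue K = Sup K - Inf K" if KD: "K \<in> D" for K
  proof -
    obtain u v where "u < v" "K = {u..v}"
      by (rule disjoint_intervalsE[OF KD assms])
    then show "K \<in> lmeasurable" "measure lebesgue K = Sup K - Inf K" by auto
  qed
  have fin: "finite D" and dis: "pairwise disjnt D"
    using assms by (auto simp: disjoint_intervals_def)
  show "\<Union>D \<in> lmeasurable"
    using fin D(1) by (intro fmeasurable.finite_Union) auto
  have "measure lebesgue (\<Union>D) = (\<Sum>K\<in>D. measure lebesgue K)"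
    using fin dis D(1) by (intro measure_Union') auto
  then show "measure lebesgue (\<Union>D) = (\<Sum>K\<in>D. Sup K - Inf K)"
    using D(2) by simp
qed

lemma disjoint_intervals_division:
  assumes "disjoint_intervals D"
  shows "D division_of \<Union>D"
proof (rule division_ofI)
  show "finite D" using assms by (simp add: disjoint_intervals_def)
  show "K \<noteq> {}" "\<exists>a b. K = cbox a b" if KD: "K \<in> D" for K
  proof -
    obtain u v where "u < v" "K = {u..v}"
      by (rule disjoint_intervalsE[OF KD assms])
    then show "K \<noteq> {}" "\<exists>a b. K = cbox a b" by (auto intro!: exI[of _ u] exI[of _ v])
  qed
  show "interior K1 \<inter> interior K2 = {}" if "K1 \<in> D" "K2 \<in> D" "K1 \<noteq> K2" for K1 K2
  proof -
    have "K1 \<inter> K2 = {}"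
      using that assms by (auto simp: disjoint_intervals_def pairwise_def disjnt_def)
    then show ?thesis using interior_subset by fastforce
  qed
qed auto

text \<open>The form used below: the property of the intervals is expressed by \<open>Inf\<close>
  and \<open>Sup\<close>, ready for slope conditions, and disjointness inside \<open>O'\<close>
  bounds the total length.\<close>

lemma Vitali_disjoint_intervals:
  fixes E :: "real set"
  assumes "open O'" "O' \<in> lmeasurable" "E \<subseteq> O'" and eta: "0 < \<eta>"
    and fine: "\<And>x d. \<lbrakk>x \<in> E; 0 < d\<rbrakk> \<Longrightarrow> \<exists>u v. u \<le> x \<and> x \<le> v \<and> u < v \<and> v - u < d \<and> P u v"
  obtains D R where "disjoint_intervals D" "\<And>K. K \<in> D \<Longrightarrow> P (Inf K) (Sup K)"
    "\<Union>D \<subseteq> O'" "R \<in> lmeasurable" "measure lebesgue R < \<eta>" "E \<subseteq> \<Union>D \<union> R"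
    "(\<Sum>K\<in>D. Sup K - Inf K) \<le> measure lebesgue O'"
proof -
  obtain D R where D: "finite D" "\<And>K. K \<in> D \<Longrightarrow> \<exists>u v. u < v \<and> K = {u..v} \<and> P u v"
    "\<Union>D \<subseteq> O'" "pairwise disjnt D" and R: "R \<in> lmeasurable" "measure lebesgue R < \<eta>" "E \<subseteq> \<Union>D \<union> R"
    using Vitali_finite_intervals[of O' E \<eta> P, OF assms(1-4) fine] by blast
  have di: "disjoint_intervals D" using D unfolding disjoint_intervals_def by blast
  have "P (Inf K) (Sup K)" if "K \<in> D" for K using D(2)[OF that] by auto
  moreover have "(\<Sum>K\<in>D. Sup K - Inf K) \<le> measure lebesgue O'"
    using measure_mono_fmeasurable[OF D(3) _ assms(2)] disjoint_intervals_measure[OF di]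
    by (auto simp: fmeasurable_def)
  ultimately show thesis using that di D(3) R by blast
qed

subsection \<open>Absolutely continuous functions\<close>

text \<open>A bijection with an initial segment of the naturals transfers the definition to any
  finite index set, such as a set of intervals or of tagged intervals. The index type
  \<open>'i\<close> is fixed before \<open>d\<close>, so each use chooses it.\<close>

lemma abs_continuous_on_IccE:
  assumes "abs_continuous_on_Icc a b f" "0 < e"
  obtains d where "0 < d"
    "\<And>I (u :: 'i \<Rightarrow> real) v. \<lbrakk>finite I; \<And>i. i \<in> I \<Longrightarrow> a \<le> u i \<and> u i \<le> v i \<and> v i \<le> b;
      disjoint_family_on (\<lambda>i. {u i<..<v i}) I; (\<Sum>i\<in>I. v i - u i) < d\<rbrakk>
      \<Longrightarrow> (\<Sum>i\<in>I. \<bar>f (v i) - f (u i)\<bar>) < e"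
proof -
  obtain d where d: "0 < d" and ac: "\<forall>n (u :: nat \<Rightarrow> real) v.
      (\<forall>i<n. a \<le> u i \<and> u i \<le> v i \<and> v i \<le> b) \<and>
      disjoint_family_on (\<lambda>i. {u i<..<v i}) {..<n} \<and>
      (\<Sum>i<n. v i - u i) < d
      \<longrightarrow> (\<Sum>i<n. \<bar>f (v i) - f (u i)\<bar>) < e"
    using assms(1)[unfolded abs_continuous_on_Icc_def, rule_format, OF assms(2)] by blast
  show thesis
  proof (rule that[OF d])
    fix I and u v :: "'i \<Rightarrow> real"
    assume I: "finite I" "\<And>i. i \<in> I \<Longrightarrow> a \<le> u i \<and> u i \<le> v i \<and> v i \<le> b"
      "disjoint_family_on (\<lambda>i. {u i<..<v i}) I" "(\<Sum>i\<in>I. v i - u i) < d"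
    obtain h where h: "bij_betw h {..<card I} I"
      using ex_bij_betw_nat_finite[OF I(1)] by (auto simp: atLeast0LessThan)
    have hI: "h i \<in> I" if "i < card I" for i using h that by (auto dest: bij_betwE)
    have "disjoint_family_on (\<lambda>i. {u (h i)<..<v (h i)}) {..<card I}"
      unfolding disjoint_family_on_def
    proof (intro ballI impI)
      fix m n assume "m \<in> {..<card I}" "n \<in> {..<card I}" "m \<noteq> n"
      moreover then have "h m \<noteq> h n" using h by (auto simp: bij_betw_def inj_on_def)
      ultimately show "{u (h m)<..<v (h m)} \<inter> {u (h n)<..<v (h n)} = {}"
        using I(3) hI unfolding disjoint_family_on_def by blast
    qed
    then have "(\<Sum>i<card I. \<bar>f (v (h i)) - f (u (h i))\<bar>) < e"
      using I hI sum.reindex_bij_betw[OF h, of "\<lambda>i. v i - u i"]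
      by (intro ac[rule_format, of _ "\<lambda>i. u (h i)" "\<lambda>i. v (h i)"]) auto
    then show "(\<Sum>i\<in>I. \<bar>f (v i) - f (u i)\<bar>) < e"
      using sum.reindex_bij_betw[OF h, of "\<lambda>i. \<bar>f (v i) - f (u i)\<bar>"] by simp
  qed
qed

lemma abs_continuous_on_Icc_subset:
  assumes "abs_continuous_on_Icc a b f" "a \<le> a'" "b' \<le> b"
  shows "abs_continuous_on_Icc a' b' f"
  unfolding abs_continuous_on_Icc_def
proof (intro allI impI)
  fix e :: real assume "0 < e"
  obtain d where "0 < d" and d: "\<forall>n (u :: nat \<Rightarrow> real) v.
      (\<forall>i<n. a \<le> u i \<and> u i \<le> v i \<and> v i \<le> b) \<and>
      disjoint_family_on (\<lambda>i. {u i<..<v i}) {..<n} \<and>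
      (\<Sum>i<n. v i - u i) < d
      \<longrightarrow> (\<Sum>i<n. \<bar>f (v i) - f (u i)\<bar>) < e"
    using assms(1)[unfolded abs_continuous_on_Icc_def, rule_format, OF \<open>0 < e\<close>] by blast
  show "\<exists>d>0. \<forall>n (u :: nat \<Rightarrow> real) v. (\<forall>i<n. a' \<le> u i \<and> u i \<le> v i \<and> v i \<le> b') \<and>
      disjoint_family_on (\<lambda>i. {u i<..<v i}) {..<n} \<and> (\<Sum>i<n. v i - u i) < d
      \<longrightarrow> (\<Sum>i<n. \<bar>f (v i) - f (u i)\<bar>) < e"
    using \<open>0 < d\<close> assms(2,3) by (intro exI[of _ d]) (force intro!: d[rule_format])
qed

text \<open>A family consisting of one interval, indexed by \<open>unit\<close>, with its endpoints
  taken in either order.\<close>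

lemma abs_continuous_on_Icc_imp_continuous_on:
  assumes "abs_continuous_on_Icc a b f"
  shows "continuous_on {a..b} f"
  unfolding continuous_on_iff
proof (intro ballI allI impI)
  fix x e :: real assume "x \<in> {a..b}" "0 < e"
  obtain d where "0 < d" and
    d: "\<And>I (u :: unit \<Rightarrow> real) v. \<lbrakk>finite I; \<And>i. i \<in> I \<Longrightarrow> a \<le> u i \<and> u i \<le> v i \<and> v i \<le> b;
      disjoint_family_on (\<lambda>i. {u i<..<v i}) I; (\<Sum>i\<in>I. v i - u i) < d\<rbrakk>
      \<Longrightarrow> (\<Sum>i\<in>I. \<bar>f (v i) - f (u i)\<bar>) < e"
    using abs_continuous_on_IccE[where 'i=unit, OF assms \<open>0 < e\<close>] by blast
  have "dist (f y) (f x) < e" if "y \<in> {a..b}" "dist y x < d" for y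
    using d[of UNIV "\<lambda>_. x" "\<lambda>_. y"] d[of UNIV "\<lambda>_. y" "\<lambda>_. x"] that \<open>x \<in> {a..b}\<close>
    by (cases "x \<le> y") (auto simp: disjoint_family_on_def dist_real_def)
  then show "\<exists>d>0. \<forall>x'\<in>{a..b}. dist x' x < d \<longrightarrow> dist (f x') (f x) < e"
    using \<open>0 < d\<close> by blast
qed

text \<open>Each interval of \<open>C\<close> is divided into the members of \<open>D\<close> inside
  it and some leftover pieces. By telescoping, the two totals differ by the increments over the
  leftover pieces, whose total length is below \<open>d\<close>.\<close>

lemma abs_continuous_on_Icc_nested_intervals:
  assumes ac: "abs_continuous_on_Icc a b f" and "0 < e"
  obtains d where "0 < d"
    "\<And>C D. \<lbrakk>disjoint_intervals C; disjoint_intervals D; \<Union>C \<subseteq> {a..b};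
        \<And>J. J \<in> D \<Longrightarrow> \<exists>K\<in>C. J \<subseteq> K;
        (\<Sum>K\<in>C. Sup K - Inf K) - (\<Sum>J\<in>D. Sup J - Inf J) < d\<rbrakk>
      \<Longrightarrow> \<bar>(\<Sum>K\<in>C. f (Sup K) - f (Inf K)) - (\<Sum>J\<in>D. f (Sup J) - f (Inf J))\<bar> < e"
proof -
  obtain d where d: "0 < d"
    and ac': "\<And>I (u :: real set \<times> real set \<Rightarrow> real) v.
      \<lbrakk>finite I; \<And>i. i \<in> I \<Longrightarrow> a \<le> u i \<and> u i \<le> v i \<and> v i \<le> b;
      disjoint_family_on (\<lambda>i. {u i<..<v i}) I; (\<Sum>i\<in>I. v i - u i) < d\<rbrakk>
      \<Longrightarrow> (\<Sum>i\<in>I. \<bar>f (v i) - f (u i)\<bar>) < e"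
    using abs_continuous_on_IccE[where 'i="real set \<times> real set", OF assms] by blast
  show thesis
  proof (rule that[OF d])
    fix C D
    assume C: "disjoint_intervals C" and D: "disjoint_intervals D" and Cab: "\<Union>C \<subseteq> {a..b}"
      and DC: "\<And>J. J \<in> D \<Longrightarrow> \<exists>K\<in>C. J \<subseteq> K"
      and small: "(\<Sum>K\<in>C. Sup K - Inf K) - (\<Sum>J\<in>D. Sup J - Inf J) < d"
    have fC: "finite C" and fD: "finite D" and dC: "pairwise disjnt C"
      using C D by (auto simp: disjoint_intervals_def)
    define DK where "DK K = {J\<in>D. J \<subseteq> K}" for K
    have fDK: "finite (DK K)" for K using fD by (simp add: DK_def)
    have "\<exists>q. DK K \<subseteq> q \<and> q division_of {Inf K..Sup K}" if "K \<in> C" for K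
    proof -
      have "disjoint_intervals (DK K)"
        using D by (auto simp: disjoint_intervals_def DK_def pairwise_def)
      then have "DK K division_of \<Union>(DK K)" by (rule disjoint_intervals_division)
      moreover have "\<Union>(DK K) \<subseteq> cbox (Inf K) (Sup K)"
        using disjoint_intervalsD(2)[OF C that] by (auto simp: DK_def)
      ultimately show ?thesis by (metis partial_division_extend_interval box_real(2))
    qed
    then obtain q where q: "\<And>K. K \<in> C \<Longrightarrow> DK K \<subseteq> q K"
      "\<And>K. K \<in> C \<Longrightarrow> q K division_of {Inf K..Sup K}"
      by metis
    have D_eq: "(\<Sum>J\<in>D. F J) = (\<Sum>K\<in>C. \<Sum>J\<in>DK K. F J)" for F :: "real set \<Rightarrow> real"
    proof -
      have "D = (\<Union>K\<in>C. DK K)" using DC by (auto simp: DK_def)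
      moreover have "DK K \<inter> DK K' = {}" if "K \<in> C" "K' \<in> C" "K \<noteq> K'" for K K'
      proof -
        have "J \<noteq> {}" if "J \<in> D" for J using disjoint_intervalsD[OF D that] by auto
        moreover have "K \<inter> K' = {}" using that dC by (auto simp: pairwise_def disjnt_def)
        ultimately show ?thesis unfolding DK_def by blast
      qed
      ultimately show ?thesis using fC fDK by (simp add: sum.UNION_disjoint)
    qed
    define G where "G = Sigma C (\<lambda>K. q K - DK K)"
    have fq: "finite (q K)" if "K \<in> C" for K using q(2)[OF that] by auto
    have fG: "finite G" using fC fq by (auto simp: G_def)
    \<comment> \<open>Stated for any \<open>F\<close>: with \<open>f\<close> it gives the difference
      of the total increments, with the identity the total length of the leftover pieces.\<close>
    have split: "(\<Sum>K\<in>C. F (Sup K) - F (Inf K)) - (\<Sum>J\<in>D. F (Sup J) - F (Inf J))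
      = (\<Sum>(K,J)\<in>G. F (Sup J) - F (Inf J))" for F :: "real \<Rightarrow> real"
    proof -
      have "F (Sup K) - F (Inf K) = (\<Sum>J\<in>DK K. F (Sup J) - F (Inf J)) + (\<Sum>J\<in>q K - DK K. F (Sup J) - F (Inf J))"
        if "K \<in> C" for K
        using sum_division_1[OF less_imp_le[OF disjoint_intervalsD(1)[OF C that]] q(2)[OF that], of F]
          sum.subset_diff[OF q(1)[OF that] fq[OF that], of "\<lambda>J. F (Sup J) - F (Inf J)"] by simp
      then have "(\<Sum>K\<in>C. F (Sup K) - F (Inf K))
        = (\<Sum>J\<in>D. F (Sup J) - F (Inf J)) + (\<Sum>K\<in>C. \<Sum>J\<in>q K - DK K. F (Sup J) - F (Inf J))"
        by (simp add: D_eq sum.distrib)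
      moreover have "(\<Sum>K\<in>C. \<Sum>J\<in>q K - DK K. F (Sup J) - F (Inf J)) = (\<Sum>(K,J)\<in>G. F (Sup J) - F (Inf J))"
        unfolding G_def using fC fq by (subst sum.Sigma) auto
      ultimately show ?thesis by simp
    qed
    have Gi: "Inf J \<le> Sup J \<and> J = {Inf J..Sup J} \<and> J \<subseteq> K" if "(K,J) \<in> G" for K J
    proof -
      have "K \<in> C" "J \<in> q K" using that by (auto simp: G_def)
      then obtain c d where "J = cbox c d" "J \<noteq> {}" using q(2)[of K] by (metis division_ofD(3,4))
      moreover have "J \<subseteq> K"
        using division_ofD(2)[OF q(2)] disjoint_intervalsD(2)[OF C] \<open>K \<in> C\<close> \<open>J \<in> q K\<close> by metis
      ultimately show ?thesis by auto
    qed
    have "(\<Sum>i\<in>G. \<bar>f (Sup (snd i)) - f (Inf (snd i))\<bar>) < e"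
    proof (rule ac'[OF fG])
      show "a \<le> Inf (snd i) \<and> Inf (snd i) \<le> Sup (snd i) \<and> Sup (snd i) \<le> b" if iG: "i \<in> G" for i
      proof -
        obtain K J where i: "i = (K,J)" by (cases i)
        have J: "Inf J \<le> Sup J" "J = {Inf J..Sup J}" "J \<subseteq> K" using Gi iG i by auto
        have "J \<subseteq> {a..b}" using J(3) Cab iG i by (auto simp: G_def)
        then have "{Inf J..Sup J} \<subseteq> {a..b}" using J(2) by simp
        then show ?thesis using J(1) i by auto
      qed
      show "disjoint_family_on (\<lambda>i. {Inf (snd i)<..<Sup (snd i)}) G"
        unfolding disjoint_family_on_def
      proof (intro ballI impI)
        fix i i' assume i: "i \<in> G" "i' \<in> G" "i \<noteq> i'"
        obtain K J K' J' where eq: "i = (K,J)" "i' = (K',J')" by (cases i, cases i') auto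
        have J: "J = {Inf J..Sup J}" "J' = {Inf J'..Sup J'}" "J \<subseteq> K" "J' \<subseteq> K'"
          using i eq Gi[of K J] Gi[of K' J'] by auto
        then have int: "interior J = {Inf J<..<Sup J}" "interior J' = {Inf J'<..<Sup J'}"
          by (metis interior_atLeastAtMost_real)+
        have "interior J \<inter> interior J' = {}"
        proof (cases "K = K'")
          case True
          then show ?thesis using i eq q(2)[of K] by (auto simp: G_def dest: division_ofD(5))
        next
          case False
          then have "K \<inter> K' = {}" using i eq dC by (auto simp: G_def pairwise_def disjnt_def)
          then show ?thesis using J interior_subset by blast
        qed
        then show "{Inf (snd i)<..<Sup (snd i)} \<inter> {Inf (snd i')<..<Sup (snd i')} = {}"
          using int eq by simp
      qed
      show "(\<Sum>i\<in>G. Sup (snd i) - Inf (snd i)) < d"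
        using small split[of "\<lambda>x. x"] by (simp add: case_prod_beta)
    qed
    moreover have "\<bar>\<Sum>i\<in>G. f (Sup (snd i)) - f (Inf (snd i))\<bar> \<le> (\<Sum>i\<in>G. \<bar>f (Sup (snd i)) - f (Inf (snd i))\<bar>)"
      by (rule sum_abs)
    ultimately show "\<bar>(\<Sum>K\<in>C. f (Sup K) - f (Inf K)) - (\<Sum>J\<in>D. f (Sup J) - f (Inf J))\<bar> < e"
      using split[of f] unfolding case_prod_beta by linarith
  qed
qed

text \<open>The points of \<open>E\<close> lie in arbitrarily short intervals of slope below \<open>p\<close> and also of slope
  above \<open>q\<close>. Covering \<open>E\<close> up to a small set by intervals of slope below \<open>p\<close>, and these again by
  intervals of slope above \<open>q\<close>, the two families have almost the same length, so by absolute
  continuity almost the same total increment.\<close>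

lemma abs_continuous_negligible_oscillation:
  assumes ac: "abs_continuous_on_Icc a b f" and pq: "p < q" and E: "E \<subseteq> {a<..<b}"
    and lo: "\<And>x d. \<lbrakk>x \<in> E; 0 < d\<rbrakk> \<Longrightarrow>
      \<exists>u v. u \<le> x \<and> x \<le> v \<and> u < v \<and> v - u < d \<and> f v - f u \<le> p * (v - u)"
    and hi: "\<And>x d. \<lbrakk>x \<in> E; 0 < d\<rbrakk> \<Longrightarrow>
      \<exists>u v. u \<le> x \<and> x \<le> v \<and> u < v \<and> v - u < d \<and> f v - f u \<ge> q * (v - u)"
  shows "negligible E"
proof -
  \<comment> \<open>\<open>m\<close> is the outer measure of \<open>E\<close>, whose measurability
    is not known at this point; it is finite since \<open>E\<close> is bounded.\<close>
  define \<M> where "\<M> = {measure lebesgue W |W. E \<subseteq> W \<and> W \<in> lmeasurable}"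
  define m where "m = Inf \<M>"
  have ne: "\<M> \<noteq> {}" using E by (auto simp: \<M>_def intro!: exI[of _ "{a<..<b}"])
  have bdd: "bdd_below \<M>" by (auto simp: \<M>_def bdd_below_def intro!: exI[of _ 0])
  have m_le: "m \<le> measure lebesgue W" if "E \<subseteq> W" "W \<in> lmeasurable" for W
    unfolding m_def using that bdd by (auto simp: \<M>_def intro!: cInf_lower)
  have m0: "0 \<le> m" unfolding m_def using ne by (auto simp: \<M>_def intro!: cInf_greatest)
  \<comment> \<open>If \<open>L1\<close> and \<open>L2\<close> are the total lengths of the outer
    and the inner family, the slopes give \<open>q * L2 - e \<le> p * L1\<close>, while both lengths
    are close to \<open>m\<close>. The bound \<open>3*\<eta>\<close> on \<open>L1 - L2\<close> comes
    from \<open>L1 < m + \<eta>\<close> and \<open>L2 > m - 2*\<eta>\<close>.\<close>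
  have key: "(q - p) * (m - \<eta>) \<le> e + \<bar>q\<bar> * (3*\<eta>)"
    if "0 < e" and eta: "0 < \<eta>" and
      d: "\<And>C D. \<lbrakk>disjoint_intervals C; disjoint_intervals D; \<Union>C \<subseteq> {a..b};
        \<And>J. J \<in> D \<Longrightarrow> \<exists>K\<in>C. J \<subseteq> K;
        (\<Sum>K\<in>C. Sup K - Inf K) - (\<Sum>J\<in>D. Sup J - Inf J) < 3*\<eta>\<rbrakk>
      \<Longrightarrow> \<bar>(\<Sum>K\<in>C. f (Sup K) - f (Inf K)) - (\<Sum>J\<in>D. f (Sup J) - f (Inf J))\<bar> < e"
    for e \<eta>
  proof -
    obtain W where W: "E \<subseteq> W" "W \<in> lmeasurable" "measure lebesgue W < m + \<eta>/2"
      using cInf_lessD[OF ne, of "m + \<eta>/2"] eta by (auto simp: \<M>_def m_def)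
    obtain U where U: "open U" "W \<subseteq> U" "(U - W) \<in> lmeasurable" "emeasure lebesgue (U - W) < ennreal (\<eta>/2)"
      using sets_lebesgue_outer_open[of W "\<eta>/2"] W(2) eta by (auto simp: fmeasurable_def)
    define O' where "O' = U \<inter> {a<..<b}"
    have O': "open O'" "E \<subseteq> O'" using U W(1) E by (auto simp: O'_def)
    have O'l: "O' \<in> lmeasurable"
      using O'(1) by (auto simp: O'_def intro: fmeasurableI2[of "{a<..<b}"])
    have "measure lebesgue O' \<le> measure lebesgue (W \<union> (U - W))"
      using U W O'l by (intro measure_mono_fmeasurable fmeasurable.Un) (auto simp: O'_def)
    also have "\<dots> \<le> measure lebesgue W + measure lebesgue (U - W)"
      using U W by (intro measure_Un_le) auto
    also have "measure lebesgue (U - W) < \<eta>/2"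
      using U(3,4) eta by (simp add: emeasure_eq_measure2 ennreal_less_iff)
    finally have mO: "measure lebesgue O' < m + \<eta>" using W(3) by simp
    obtain C R where C: "disjoint_intervals C"
      "\<And>K. K \<in> C \<Longrightarrow> f (Sup K) - f (Inf K) \<le> p * (Sup K - Inf K)" "\<Union>C \<subseteq> O'"
      and R: "R \<in> lmeasurable" "measure lebesgue R < \<eta>" "E \<subseteq> \<Union>C \<union> R"
      and CO: "(\<Sum>K\<in>C. Sup K - Inf K) \<le> measure lebesgue O'"
      using Vitali_disjoint_intervals[of O' E \<eta> "\<lambda>u v. f v - f u \<le> p * (v - u)",
            OF O'(1) O'l O'(2) eta lo] by blast
    \<comment> \<open>An interval around \<open>x\<close> fits into a single member of
      \<open>C\<close> once it is short, provided that \<open>x\<close> is an interior point.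
      Passing to the interiors loses only finitely many endpoints.\<close>
    define V where "V = (\<Union>K\<in>C. interior K)"
    have Vo: "open V" by (auto simp: V_def)
    have VC: "V \<subseteq> \<Union>C" unfolding V_def using interior_subset by fastforce
    have Cl: "\<Union>C \<in> lmeasurable" by (rule disjoint_intervals_measure[OF C(1)])
    have Vl: "V \<in> lmeasurable" using Vo VC Cl by (intro fmeasurableI2[OF Cl]) auto
    define Q where "Q u v \<longleftrightarrow> f v - f u \<ge> q * (v - u) \<and> (\<exists>K\<in>C. {u..v} \<subseteq> K)" for u v
    have fineV: "\<exists>u v. u \<le> x \<and> x \<le> v \<and> u < v \<and> v - u < \<delta> \<and> Q u v"
      if xV: "x \<in> E \<inter> V" and \<delta>: "0 < \<delta>" for x \<delta>
    proof -
      obtain K where K: "K \<in> C" "x \<in> interior K" using xV by (auto simp: V_def)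
      obtain r where r: "r > 0" "ball x r \<subseteq> K" using K(2) by (auto simp: mem_interior)
      obtain u v where uv: "u \<le> x" "x \<le> v" "u < v" "v - u < min r \<delta>" "f v - f u \<ge> q * (v - u)"
        using hi[of x "min r \<delta>"] xV \<delta> r by auto
      have "{u..v} \<subseteq> ball x r" using uv by (auto simp: dist_real_def)
      then have "{u..v} \<subseteq> K" using r by blast
      then have "Q u v" using uv K by (auto simp: Q_def)
      then show ?thesis using uv by auto
    qed
    obtain D S where D: "disjoint_intervals D" "\<And>J. J \<in> D \<Longrightarrow> Q (Inf J) (Sup J)"
      and S: "S \<in> lmeasurable" "measure lebesgue S < \<eta>" "E \<inter> V \<subseteq> \<Union>D \<union> S"
    proof (rule Vitali_disjoint_intervals[of V "E \<inter> V" \<eta> Q, OF Vo Vl Int_lower2 eta fineV])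
      fix D S assume "disjoint_intervals D" and Q: "\<And>J. J \<in> D \<Longrightarrow> Q (Inf J) (Sup J)"
        and "S \<in> lmeasurable" "measure lebesgue S < \<eta>" "E \<inter> V \<subseteq> \<Union>D \<union> S"
      then show thesis by (rule that)
    qed
    have DC: "\<exists>K\<in>C. J \<subseteq> K" if "J \<in> D" for J
      using D(2)[OF that] disjoint_intervalsD(2)[OF D(1) that] by (auto simp: Q_def)
    define L1 where "L1 = (\<Sum>K\<in>C. Sup K - Inf K)"
    define L2 where "L2 = (\<Sum>J\<in>D. Sup J - Inf J)"
    have Dl: "\<Union>D \<in> lmeasurable" "measure lebesgue (\<Union>D) = L2"
      unfolding L2_def by (rule disjoint_intervals_measure[OF D(1)])+
    have nF: "negligible (\<Union>C - V)"
    proof -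
      have "\<Union>C - V \<subseteq> (\<Union>K\<in>C. {Inf K, Sup K})"
      proof
        fix x assume "x \<in> \<Union>C - V"
        then obtain K where "K \<in> C" "x \<in> K" "x \<notin> interior K" by (auto simp: V_def)
        moreover have "interior K = {Inf K<..<Sup K}"
          using disjoint_intervalsD(2)[OF C(1) \<open>K \<in> C\<close>] by (metis interior_atLeastAtMost_real)
        moreover have "x \<in> {Inf K..Sup K}"
          using disjoint_intervalsD(2)[OF C(1) \<open>K \<in> C\<close>] \<open>x \<in> K\<close> by simp
        ultimately show "x \<in> (\<Union>K\<in>C. {Inf K, Sup K})" by force
      qed
      moreover have "finite (\<Union>K\<in>C. {Inf K, Sup K})" using C(1) by (simp add: disjoint_intervals_def)
      ultimately show ?thesis by (meson negligible_finite negligible_subset)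
    qed
    \<comment> \<open>\<open>E\<close> is covered by \<open>D\<close>, the two remainders
      \<open>S\<close> and \<open>R\<close> of measure below \<open>\<eta>\<close> each, and the
      lost endpoints.\<close>
    have "m \<le> measure lebesgue ((\<Union>D \<union> S) \<union> (R \<union> (\<Union>C - V)))"
      using R(3) S(3) VC nF Dl(1) S(1) R(1)
      by (intro m_le fmeasurable.Un) (auto simp: negligible_iff_measure)
    also have "\<dots> \<le> measure lebesgue (\<Union>D \<union> S) + measure lebesgue (R \<union> (\<Union>C - V))"
      using nF Dl(1) S(1) R(1) by (intro measure_Un_le sets.Un) (auto simp: negligible_iff_measure)
    also have "\<dots> \<le> (measure lebesgue (\<Union>D) + measure lebesgue S) + (measure lebesgue R + measure lebesgue (\<Union>C - V))"
      using nF Dl(1) S(1) R(1) by (intro add_mono measure_Un_le) (auto simp: negligible_iff_measure)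
    also have "\<dots> < L2 + 2*\<eta>"
      using nF S(2) R(2) Dl(2) by (auto simp: negligible_iff_measure)
    finally have mL2: "m < L2 + 2*\<eta>" .
    have L1u: "L1 < m + \<eta>" using CO mO by (simp add: L1_def)
    have "m \<le> measure lebesgue (\<Union>C \<union> R)" using R Cl by (intro m_le) auto
    also have "\<dots> \<le> measure lebesgue (\<Union>C) + measure lebesgue R"
      using R Cl by (intro measure_Un_le) auto
    finally have L1l: "m - \<eta> < L1"
      using R(2) disjoint_intervals_measure(2)[OF C(1)] by (simp add: L1_def)
    have "\<Union>C \<subseteq> {a..b}" using C(3) by (force simp: O'_def)
    then have "\<bar>(\<Sum>K\<in>C. f (Sup K) - f (Inf K)) - (\<Sum>J\<in>D. f (Sup J) - f (Inf J))\<bar> < e"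
      using d[OF C(1) D(1) _ DC] L1u mL2 by (simp add: L1_def L2_def)
    moreover have "(\<Sum>K\<in>C. f (Sup K) - f (Inf K)) \<le> p * L1"
      unfolding L1_def sum_distrib_left using C(2) by (rule sum_mono)
    moreover have "q * L2 \<le> (\<Sum>J\<in>D. f (Sup J) - f (Inf J))"
      unfolding L2_def sum_distrib_left using D(2) by (intro sum_mono) (auto simp: Q_def)
    ultimately have 1: "q * L2 - e \<le> p * L1" by linarith
    have L21: "L2 \<le> L1"
    proof -
      have "\<Union>D \<subseteq> \<Union>C" using DC by blast
      then have "measure lebesgue (\<Union>D) \<le> measure lebesgue (\<Union>C)"
        using Dl(1) Cl by (intro measure_mono_fmeasurable) auto
      then show ?thesis using Dl(2) disjoint_intervals_measure(2)[OF C(1)] by (simp add: L1_def)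
    qed
    have "q * (L1 - L2) \<le> \<bar>q\<bar> * (3*\<eta>)"
      using L21 L1u mL2 by (intro mult_mono) auto
    then have "(q - p) * L1 \<le> e + \<bar>q\<bar> * (3*\<eta>)"
      using 1 by (simp add: algebra_simps)
    moreover have "(q - p) * (m - \<eta>) \<le> (q - p) * L1"
      using pq L1l by (intro mult_left_mono) auto
    ultimately show ?thesis by linarith
  qed
  have "(q - p) * m \<le> 0"
  proof (rule field_le_epsilon)
    fix \<epsilon> :: real assume "0 < \<epsilon>"
    obtain d where d: "0 < d" and dd: "\<And>C D. \<lbrakk>disjoint_intervals C; disjoint_intervals D; \<Union>C \<subseteq> {a..b};
        \<And>J. J \<in> D \<Longrightarrow> \<exists>K\<in>C. J \<subseteq> K;
        (\<Sum>K\<in>C. Sup K - Inf K) - (\<Sum>J\<in>D. Sup J - Inf J) < d\<rbrakk>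
      \<Longrightarrow> \<bar>(\<Sum>K\<in>C. f (Sup K) - f (Inf K)) - (\<Sum>J\<in>D. f (Sup J) - f (Inf J))\<bar> < \<epsilon>/2"
      using abs_continuous_on_Icc_nested_intervals[OF ac half_gt_zero[OF \<open>0 < \<epsilon>\<close>]] by blast
    \<comment> \<open>\<open>c\<close> collects the coefficients of \<open>\<eta>\<close> in
      \<open>key\<close>; the two terms of the minimum below give \<open>3 * \<eta> \<le> d\<close>
      and \<open>c * \<eta> \<le> \<epsilon>/2\<close>.\<close>
    define c where "c = (q - p) + 3 * \<bar>q\<bar>"
    have c: "c > 0" using pq by (simp add: c_def)
    define \<eta> where "\<eta> = min (d/3) (\<epsilon>/(2*c))"
    have eta: "0 < \<eta>" using d c \<open>0 < \<epsilon>\<close> by (simp add: \<eta>_def)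
    have "3 * \<eta> \<le> d" by (simp add: \<eta>_def)
    then have "(q - p) * (m - \<eta>) \<le> \<epsilon>/2 + \<bar>q\<bar> * (3*\<eta>)"
      using \<open>0 < \<epsilon>\<close> eta dd by (intro key) auto
    then have "(q - p) * m \<le> \<epsilon>/2 + c * \<eta>" by (simp add: c_def algebra_simps)
    also have "c * \<eta> \<le> c * (\<epsilon>/(2*c))" using c by (intro mult_left_mono) (auto simp: \<eta>_def)
    also have "\<dots> = \<epsilon>/2" using c by simp
    finally show "(q - p) * m \<le> 0 + \<epsilon>" by simp
  qed
  then have "m = 0" using m0 pq by (simp add: mult_le_0_iff)
  show ?thesis unfolding negligible_outer
  proof (intro allI impI)
    fix e :: real assume "0 < e"
    then obtain x where "x \<in> \<M>" "x < e"
      using cInf_lessD[OF ne, of e] \<open>m = 0\<close> by (auto simp: m_def)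
    then show "\<exists>T. E \<subseteq> T \<and> T \<in> lmeasurable \<and> measure lebesgue T < e" by (auto simp: \<M>_def)
  qed
qed

text \<open>Disjoint intervals of total length below \<open>d\<close> have total absolute increment
  below \<open>1\<close>; if each has slope at least \<open>M\<close> in absolute value, their total
  length is below \<open>1/M\<close>. As \<open>M\<close> is arbitrary, Vitali coverings make
  \<open>E\<close> null.\<close>

lemma abs_continuous_negligible_infinite_slope:
  assumes ac: "abs_continuous_on_Icc a b f" and E: "E \<subseteq> {a<..<b}"
    and hi: "\<And>x d M. \<lbrakk>x \<in> E; 0 < d\<rbrakk> \<Longrightarrow>
      \<exists>u v. u \<le> x \<and> x \<le> v \<and> u < v \<and> v - u < d \<and> M * (v - u) \<le> \<bar>f v - f u\<bar>"
  shows "negligible E"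
proof -
  obtain d where d: "0 < d" and dd: "\<And>I (u :: real set \<Rightarrow> real) v. \<lbrakk>finite I;
      \<And>i. i \<in> I \<Longrightarrow> a \<le> u i \<and> u i \<le> v i \<and> v i \<le> b;
      disjoint_family_on (\<lambda>i. {u i<..<v i}) I; (\<Sum>i\<in>I. v i - u i) < d\<rbrakk>
      \<Longrightarrow> (\<Sum>i\<in>I. \<bar>f (v i) - f (u i)\<bar>) < 1"
    using abs_continuous_on_IccE[where 'i="real set", OF ac zero_less_one] by blast
  \<comment> \<open>Disjoint intervals in a ball of radius \<open>d/3\<close> have total length at
    most \<open>2*d/3\<close>, so absolute continuity applies to them. Negligibility is a local
    property.\<close>
  have loc: "negligible (E \<inter> ball z (d/3))" for z
    unfolding negligible_outer_le
  proof (intro allI impI)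
    fix e :: real assume "0 < e"
    define O' where "O' = ball z (d/3) \<inter> {a<..<b}"
    have O': "open O'" "O' \<in> lmeasurable" "E \<inter> ball z (d/3) \<subseteq> O'"
      using E by (auto simp: O'_def intro: fmeasurableI2[of "ball z (d/3)"])
    have mO: "measure lebesgue O' < d"
    proof -
      have "measure lebesgue O' \<le> measure lebesgue (ball z (d/3))"
        using O' by (intro measure_mono_fmeasurable) (auto simp: O'_def)
      also have "\<dots> = 2*d/3" using d by (simp add: ball_eq_greaterThanLessThan)
      finally show ?thesis using d by simp
    qed
    \<comment> \<open>With \<open>M = 2/e\<close> the intervals have total length below
      \<open>e/2\<close>; the remainder \<open>R\<close> takes the other half.\<close>
    define M where "M = 2/e"
    have M: "M > 0" using \<open>0 < e\<close> by (simp add: M_def)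
    obtain D R where D: "disjoint_intervals D"
      "\<And>K. K \<in> D \<Longrightarrow> M * (Sup K - Inf K) \<le> \<bar>f (Sup K) - f (Inf K)\<bar>" "\<Union>D \<subseteq> O'"
      and R: "R \<in> lmeasurable" "measure lebesgue R < e/2" "E \<inter> ball z (d/3) \<subseteq> \<Union>D \<union> R"
      and DO: "(\<Sum>K\<in>D. Sup K - Inf K) \<le> measure lebesgue O'"
      using Vitali_disjoint_intervals[of O' "E \<inter> ball z (d/3)" "e/2"
          "\<lambda>u v. M * (v - u) \<le> \<bar>f v - f u\<bar>", OF O'] hi \<open>0 < e\<close> by auto
    have "(\<Sum>K\<in>D. \<bar>f (Sup K) - f (Inf K)\<bar>) < 1"
    proof (rule dd)
      show "finite D" using D(1) by (simp add: disjoint_intervals_def)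
      show "a \<le> Inf K \<and> Inf K \<le> Sup K \<and> Sup K \<le> b" if "K \<in> D" for K
      proof -
        have "Inf K < Sup K" "K = {Inf K..Sup K}" using disjoint_intervalsD[OF D(1) that] .
        moreover have "K \<subseteq> {a..b}" using D(3) that by (force simp: O'_def)
        ultimately have "Inf K \<in> {a..b}" "Sup K \<in> {a..b}"
          by (metis atLeastAtMost_iff less_imp_le order_refl subsetD)+
        then show ?thesis using \<open>Inf K < Sup K\<close> by simp
      qed
      show "disjoint_family_on (\<lambda>K. {Inf K<..<Sup K}) D"
        unfolding disjoint_family_on_def
      proof (intro ballI impI)
        fix K K' assume K: "K \<in> D" "K' \<in> D" "K \<noteq> K'"
        then have "K \<inter> K' = {}" using D(1) by (auto simp: disjoint_intervals_def pairwise_def disjnt_def)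
        moreover have "{Inf K<..<Sup K} \<subseteq> K" "{Inf K'<..<Sup K'} \<subseteq> K'"
          using disjoint_intervalsD(2)[OF D(1)] K by (metis greaterThanLessThan_subseteq_atLeastAtMost_iff order_refl)+
        ultimately show "{Inf K<..<Sup K} \<inter> {Inf K'<..<Sup K'} = {}" by blast
      qed
      show "(\<Sum>K\<in>D. Sup K - Inf K) < d" using DO mO by simp
    qed
    moreover have "M * (\<Sum>K\<in>D. Sup K - Inf K) \<le> (\<Sum>K\<in>D. \<bar>f (Sup K) - f (Inf K)\<bar>)"
      unfolding sum_distrib_left using D(2) by (rule sum_mono)
    ultimately have "M * (\<Sum>K\<in>D. Sup K - Inf K) < 1" by simp
    then have "(\<Sum>K\<in>D. Sup K - Inf K) < e/2" using \<open>0 < e\<close> by (simp add: M_def field_simps)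
    then have "measure lebesgue (\<Union>D \<union> R) \<le> e"
      using measure_Un_le[of "\<Union>D" lebesgue R] disjoint_intervals_measure[OF D(1)] R by auto
    then show "\<exists>T. E \<inter> ball z (d/3) \<subseteq> T \<and> T \<in> lmeasurable \<and> measure lebesgue T \<le> e"
      using R disjoint_intervals_measure(1)[OF D(1)] by (intro exI[of _ "\<Union>D \<union> R"]) auto
  qed
  show ?thesis
  proof (rule locally_negligible_alt[THEN iffD2], rule ballI)
    fix x assume "x \<in> E"
    then show "\<exists>U. openin (top_of_set E) U \<and> x \<in> U \<and> negligible U"
      using loc[of x] d by (intro exI[of _ "E \<inter> ball x (d/3)"]) auto
  qed
qed

text \<open>Outside the exceptional sets the slopes over short intervals containing \<open>x\<close>
  are bounded and do not oscillate, so they converge, and the limit is the derivative. Rational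
  \<open>p < q\<close> suffice to detect oscillation, which keeps the union of null sets
  countable.\<close>

theorem abs_continuous_differentiable_ae:
  assumes ac: "abs_continuous_on_Icc a b f"
  shows "negligible {x\<in>{a<..<b}. \<not> f differentiable (at x)}"
proof -
  \<comment> \<open>\<open>u = x\<close> and \<open>v = x\<close> are allowed, so the difference
    quotients at \<open>x\<close> are among the slopes considered.\<close>
  define str where "str x d u v \<longleftrightarrow> u \<le> x \<and> x \<le> v \<and> u < v \<and> v - u < d" for x d u v :: real
  define Lo where "Lo p = {x\<in>{a<..<b}. \<forall>d>0. \<exists>u v. str x d u v \<and> f v - f u \<le> p * (v - u)}" for p
  define Hi where "Hi q = {x\<in>{a<..<b}. \<forall>d>0. \<exists>u v. str x d u v \<and> f v - f u \<ge> q * (v - u)}" for q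
  define In where "In = {x\<in>{a<..<b}. \<forall>M. \<forall>d>0. \<exists>u v. str x d u v \<and> M * (v - u) \<le> \<bar>f v - f u\<bar>}"
  have "negligible (Lo p \<inter> Hi q)" if "p < q" for p q
    using ac that
  proof (rule abs_continuous_negligible_oscillation)
    show "Lo p \<inter> Hi q \<subseteq> {a<..<b}" by (auto simp: Lo_def)
  qed (simp_all add: Lo_def Hi_def str_def conj_ac)
  moreover have "negligible In"
    using ac
  proof (rule abs_continuous_negligible_infinite_slope)
    show "In \<subseteq> {a<..<b}" by (auto simp: In_def)
  qed (simp add: In_def str_def conj_ac)
  ultimately have "negligible (In \<union> (\<Union>(p,q)\<in>{(p,q)\<in>\<rat>\<times>\<rat>. p < q}. Lo p \<inter> Hi q))"
    by (intro negligible_Un negligible_countable_Union)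
      (auto intro!: countable_image intro: countable_subset[OF _ countable_SIGMA[OF countable_rat countable_rat]])
  moreover have "{x\<in>{a<..<b}. \<not> f differentiable (at x)} \<subseteq> In \<union> (\<Union>(p,q)\<in>{(p,q)\<in>\<rat>\<times>\<rat>. p < q}. Lo p \<inter> Hi q)"
  proof (intro subsetI, rule ccontr)
    fix x assume x: "x \<in> {x\<in>{a<..<b}. \<not> f differentiable (at x)}"
      and nx: "x \<notin> In \<union> (\<Union>(p,q)\<in>{(p,q)\<in>\<rat>\<times>\<rat>. p < q}. Lo p \<inter> Hi q)"
    have xab: "x \<in> {a<..<b}" using x by simp
    \<comment> \<open>Only rational pairs are excluded, but \<open>Hi\<close> shrinks as its
      argument grows, so a rational \<open>q'\<close> between \<open>p\<close> and \<open>q\<close>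
      covers every real \<open>q\<close>.\<close>
    have pq: "x \<notin> Lo p" if "x \<in> Hi q" "p \<in> \<rat>" "p < q" for p q
    proof -
      obtain q' where q': "q' \<in> \<rat>" "p < q'" "q' < q" using \<open>p < q\<close> Rats_dense_in_real by blast
      have "x \<in> Hi q'" unfolding Hi_def
      proof (intro CollectI conjI allI impI xab)
        fix d :: real assume "0 < d"
        then obtain u v where uv: "str x d u v" "f v - f u \<ge> q * (v - u)"
          using \<open>x \<in> Hi q\<close> by (auto simp: Hi_def)
        moreover have "q' * (v - u) \<le> q * (v - u)"
          using uv q' by (intro mult_right_mono) (auto simp: str_def)
        ultimately show "\<exists>u v. str x d u v \<and> f v - f u \<ge> q' * (v - u)" by force
      qed
      then show ?thesis using nx q' \<open>p \<in> \<rat>\<close> by auto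
    qed
    obtain M d0 where d0: "d0 > 0" and M: "\<And>u v. str x d0 u v \<Longrightarrow> \<bar>f v - f u\<bar> < M * (v - u)"
      using nx xab by (auto simp: In_def not_le)
    \<comment> \<open>\<open>A\<close> contains \<open>-M\<close> and is bounded above by
      \<open>M\<close>. Its supremum \<open>L\<close> is the upper limit of the slopes at
      \<open>x\<close>, hence the candidate for the derivative.\<close>
    define A where "A = {q. x \<in> Hi q}"
    have str_ex: "\<exists>u v. str x d u v" if "d > 0" for d
      using that by (intro exI[of _ x] exI[of _ "x + d/2"]) (auto simp: str_def)
    have str_min: "str x (min d d') u v \<longleftrightarrow> str x d u v \<and> str x d' u v" for d d' u v
      by (auto simp: str_def)
    have "x \<in> Hi (-M)" unfolding Hi_def
    proof (intro CollectI conjI allI impI xab)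
      fix d :: real assume "0 < d"
      then obtain u v where "str x (min d d0) u v" using str_ex d0 by (metis min_less_iff_conj)
      then show "\<exists>u v. str x d u v \<and> f v - f u \<ge> - M * (v - u)"
        using M[of u v] unfolding str_min by (intro exI[of _ u] exI[of _ v]) auto
    qed
    then have Ane: "A \<noteq> {}" by (auto simp: A_def)
    have "q \<le> M" if "q \<in> A" for q
    proof -
      obtain u v where uv: "str x d0 u v" "f v - f u \<ge> q * (v - u)"
        using \<open>q \<in> A\<close> d0 by (auto simp: A_def Hi_def)
      then have "q * (v - u) < M * (v - u)" using M[of u v] by auto
      then show ?thesis using uv by (auto simp: str_def)
    qed
    then have Abdd: "bdd_above A" by (auto simp: bdd_above_def)
    define L where "L = Sup A"
    have "(f has_field_derivative L) (at x)"
      unfolding has_field_derivative_iff tendsto_iff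
    proof (intro allI impI)
      fix e :: real assume "0 < e"
      \<comment> \<open>Slopes near \<open>x\<close> stay below \<open>L + e\<close>, as otherwise
        \<open>L + e\<close> would belong to \<open>A\<close>. They stay above a rational
        \<open>p > L - e\<close>, as otherwise \<open>x\<close> would lie in both
        \<open>Lo p\<close> and \<open>Hi q\<close> with \<open>p < q\<close>.\<close>
      have "x \<notin> Hi (L + e)"
      proof
        assume "x \<in> Hi (L + e)"
        then have "L + e \<le> L" unfolding L_def using Abdd by (intro cSup_upper) (auto simp: A_def)
        then show False using \<open>0 < e\<close> by simp
      qed
      then obtain d1 where d1: "d1 > 0" "\<And>u v. str x d1 u v \<Longrightarrow> f v - f u < (L + e) * (v - u)"
        using xab by (auto simp: Hi_def not_le)
      obtain q where q: "q \<in> A" "L - e < q"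
        using less_cSupD[OF Ane, of "L - e"] \<open>0 < e\<close> by (auto simp: L_def)
      obtain p where p: "p \<in> \<rat>" "L - e < p" "p < q" using q Rats_dense_in_real by blast
      then have "x \<notin> Lo p" using pq q by (auto simp: A_def)
      then obtain d2 where d2: "d2 > 0" "\<And>u v. str x d2 u v \<Longrightarrow> f v - f u > p * (v - u)"
        using xab by (auto simp: Lo_def not_le)
      have "dist ((f y - f x) / (y - x)) L < e" if y: "y \<noteq> x" "dist y x < min d1 d2" for y
      proof -
        define u where "u = min x y"
        define v where "v = max x y"
        have s: "str x d1 u v" "str x d2 u v" and uv: "u < v"
          using y by (auto simp: str_def u_def v_def dist_real_def)
        have eq: "(f y - f x) / (y - x) = (f v - f u) / (v - u)"
          using y by (auto simp: u_def v_def min_def max_def divide_simps) (simp add: algebra_simps)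
        have "(f v - f u) / (v - u) < L + e" using d1(2)[OF s(1)] uv by (simp add: field_simps)
        moreover have "L - e < (f v - f u) / (v - u)"
        proof -
          have "p < (f v - f u) / (v - u)" using d2(2)[OF s(2)] uv by (simp add: field_simps)
          then show ?thesis using p by simp
        qed
        ultimately show ?thesis unfolding eq dist_real_def by linarith
      qed
      then show "\<forall>\<^sub>F y in at x. dist ((f y - f x) / (y - x)) L < e"
        unfolding eventually_at using d1 d2 by (intro exI[of _ "min d1 d2"]) auto
    qed
    then show False using x by (auto simp: real_differentiable_def)
  qed
  ultimately show ?thesis by (rule negligible_subset)
qed

text \<open>Tags in the exceptional null set \<open>N\<close> contribute little by absolute continuity, once the gauge
  forces their intervals into an open set of small measure.\<close>

theorem abs_continuous_increment_le_integral:
  assumes ac: "abs_continuous_on_Icc a b f" and ab: "a \<le> b"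
    and g: "g integrable_on {a..b}" and N: "negligible N"
    and deriv: "\<And>x. x \<in> {a..b} - N \<Longrightarrow> \<exists>D\<le>g x. (f has_real_derivative D) (at x within {a..b})"
  shows "f b - f a \<le> integral {a..b} g"
proof -
  \<comment> \<open>Setting the integrand to zero on \<open>N\<close> preserves the integral and
    removes the tags in \<open>N\<close> from the Riemann sum.\<close>
  define g0 where "g0 x = (if x \<in> N then 0 else g x)" for x
  have g0: "(g0 has_integral integral {a..b} g) (cbox a b)"
    using has_integral_spike[OF N, of "{a..b}" g0 g] g by (auto simp: g0_def)
  \<comment> \<open>The factor \<open>b - a + 2\<close> counts \<open>e\<close> per unit length from
    the derivative estimates, one \<open>e\<close> from the Riemann sum and one from the tags in
    \<open>N\<close>.\<close>
  have key: "f b - f a \<le> integral {a..b} g + e * (b - a + 2)" if e: "0 < e" for e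
  proof -
    obtain \<gamma>1 where \<gamma>1: "gauge \<gamma>1" "\<And>p. p tagged_division_of cbox a b \<Longrightarrow> \<gamma>1 fine p \<Longrightarrow>
        norm ((\<Sum>(x,k)\<in>p. measure lborel k *\<^sub>R g0 x) - integral {a..b} g) < e"
      using g0 e unfolding has_integral by metis
    obtain d where d: "0 < d" and dd: "\<And>I (u :: real \<times> real set \<Rightarrow> real) v. \<lbrakk>finite I;
      \<And>i. i \<in> I \<Longrightarrow> a \<le> u i \<and> u i \<le> v i \<and> v i \<le> b;
      disjoint_family_on (\<lambda>i. {u i<..<v i}) I; (\<Sum>i\<in>I. v i - u i) < d\<rbrakk>
      \<Longrightarrow> (\<Sum>i\<in>I. \<bar>f (v i) - f (u i)\<bar>) < e"
      using abs_continuous_on_IccE[where 'i="real \<times> real set", OF ac e] by blast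
    obtain U where U: "open U" "N \<subseteq> U" "(U - N) \<in> lmeasurable" "emeasure lebesgue (U - N) < ennreal d"
      using sets_lebesgue_outer_open[of N d] N d by (auto simp: negligible_imp_sets)
    have Nl: "N \<in> lmeasurable" "measure lebesgue N = 0" using N by (auto simp: negligible_iff_measure)
    have UN: "U = (U - N) \<union> N" using U(2) by blast
    have Ul: "U \<in> lmeasurable" using fmeasurable.Un[OF U(3) Nl(1)] UN by simp
    have "measure lebesgue U \<le> measure lebesgue (U - N) + measure lebesgue N"
      using measure_Un_le[of "U - N" lebesgue N] U(3) Nl UN by auto
    also have "\<dots> < d" using U(3,4) d Nl by (simp add: emeasure_eq_measure2 ennreal_less_iff)
    finally have mU: "measure lebesgue U < d" .
    \<comment> \<open>The interval contains its tag \<open>x\<close>, so the linearization errors at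
      its two ends add up to \<open>e * (v - u)\<close>.\<close>
    have "\<exists>\<delta>>0. \<forall>u v. u \<in> {a..b} \<and> v \<in> {a..b} \<and> u \<le> x \<and> x \<le> v \<and> {u..v} \<subseteq> ball x \<delta>
        \<longrightarrow> f v - f u \<le> (g x + e) * (v - u)" if x: "x \<in> {a..b} - N" for x
    proof -
      obtain D where D: "D \<le> g x" "(f has_real_derivative D) (at x within {a..b})"
        using deriv[OF x] by blast
      then obtain \<delta> where \<delta>: "\<delta> > 0" "\<And>y. y \<in> {a..b} \<Longrightarrow> norm (y - x) < \<delta> \<Longrightarrow>
          norm (f y - f x - D * (y - x)) \<le> e * norm (y - x)"
        using e unfolding has_field_derivative_def has_derivative_within_alt by blast
      have "f v - f u \<le> (g x + e) * (v - u)"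
        if uv: "u \<in> {a..b}" "v \<in> {a..b}" "u \<le> x" "x \<le> v" "{u..v} \<subseteq> ball x \<delta>" for u v
      proof -
        have "u \<in> ball x \<delta>" "v \<in> ball x \<delta>" using uv by (auto intro!: subsetD[OF uv(5)] simp del: mem_ball)
        then have "\<bar>f v - f x - D * (v - x)\<bar> \<le> e * (v - x)" "\<bar>f u - f x - D * (u - x)\<bar> \<le> e * (x - u)"
          using \<delta>(2)[of v] \<delta>(2)[of u] uv by (auto simp: dist_real_def)
        then have "f v - f u \<le> (D + e) * (v - u)" by (simp add: algebra_simps)
        also have "\<dots> \<le> (g x + e) * (v - u)" using D uv by (intro mult_right_mono) auto
        finally show ?thesis .
      qed
      then show ?thesis using \<delta>(1) by blast
    qed
    then obtain \<delta> where \<delta>: "\<And>x. x \<in> {a..b} - N \<Longrightarrow> \<delta> x > 0"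
      "\<And>x u v. \<lbrakk>x \<in> {a..b} - N; u \<in> {a..b}; v \<in> {a..b}; u \<le> x; x \<le> v; {u..v} \<subseteq> ball x (\<delta> x)\<rbrakk>
        \<Longrightarrow> f v - f u \<le> (g x + e) * (v - u)"
      by metis
    \<comment> \<open>Tags in \<open>N\<close> force their intervals into the small open set
      \<open>U\<close>. The radius \<open>1\<close> is a default outside \<open>{a..b}\<close>,
      where no tag lies.\<close>
    define \<gamma>2 where "\<gamma>2 x = (if x \<in> N then U else ball x (if x \<in> {a..b} then \<delta> x else 1))" for x
    have "gauge \<gamma>2" using U \<delta>(1) by (auto simp: gauge_def \<gamma>2_def)
    then obtain p where p: "p tagged_division_of cbox a b" "\<gamma>1 fine p" "\<gamma>2 fine p"
      using fine_division_exists[OF gauge_Int[OF \<gamma>1(1)]] by (metis fine_Int)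
    have fp: "finite p" using p(1) by auto
    have pK: "Inf K \<le> Sup K \<and> K = {Inf K..Sup K} \<and> x \<in> K \<and> x \<in> {a..b} \<and> Inf K \<in> {a..b} \<and> Sup K \<in> {a..b} \<and>
        K \<subseteq> \<gamma>2 x \<and> measure lborel K = Sup K - Inf K"
      if xK: "(x,K) \<in> p" for x K
    proof -
      have 1: "x \<in> K" "K \<subseteq> {a..b}" using tagged_division_ofD(2,3)[OF p(1) xK] by auto
      obtain u v where K: "K = {u..v}" using tagged_division_ofD(4)[OF p(1) xK] by auto
      have "u \<le> v" using 1 K by auto
      then show ?thesis using 1 K fineD[OF p(3) xK] by auto
    qed
    define pN where "pN = {i\<in>p. fst i \<in> N}"
    have pNp: "pN \<subseteq> p" by (auto simp: pN_def)
    then have fN: "finite pN" using fp finite_subset by blast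
    have disj: "disjoint_family_on (\<lambda>i. {Inf (snd i)<..<Sup (snd i)}) pN"
      unfolding disjoint_family_on_def
    proof (intro ballI impI)
      fix i i' assume i: "i \<in> pN" "i' \<in> pN" "i \<noteq> i'"
      obtain x K x' K' where eq: "i = (x,K)" "i' = (x',K')" by (cases i, cases i') auto
      have xK: "(x,K) \<in> p" "(x',K') \<in> p" using i eq by (auto simp: pN_def)
      then have "interior K \<inter> interior K' = {}"
        using tagged_division_ofD(5)[OF p(1)] i eq by blast
      moreover have "interior K = {Inf K<..<Sup K}" "interior K' = {Inf K'<..<Sup K'}"
        using pK xK by (metis interior_atLeastAtMost_real)+
      ultimately show "{Inf (snd i)<..<Sup (snd i)} \<inter> {Inf (snd i')<..<Sup (snd i')} = {}"
        using eq by simp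
    qed
    have pN: "a \<le> Inf (snd i) \<and> Inf (snd i) \<le> Sup (snd i) \<and> Sup (snd i) \<le> b" if "i \<in> pN" for i
      using pK[of "fst i" "snd i"] that by (auto simp: pN_def)
    have "(\<Sum>i\<in>pN. Sup (snd i) - Inf (snd i)) = (\<Sum>i\<in>pN. measure lebesgue {Inf (snd i)<..<Sup (snd i)})"
      using pN by (intro sum.cong) auto
    also have "\<dots> = measure lebesgue (\<Union>i\<in>pN. {Inf (snd i)<..<Sup (snd i)})"
      using fN disj pN by (intro measure_finite_Union[symmetric]) auto
    also have "\<dots> \<le> measure lebesgue U"
    proof (rule measure_mono_fmeasurable[OF _ _ Ul])
      show "(\<Union>i\<in>pN. {Inf (snd i)<..<Sup (snd i)}) \<subseteq> U"
      proof (rule UN_least)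
        fix i assume i: "i \<in> pN"
        then obtain x K where eq: "i = (x,K)" "(x,K) \<in> p" "x \<in> N" by (cases i) (auto simp: pN_def)
        have "{Inf K<..<Sup K} \<subseteq> {Inf K..Sup K}" by auto
        also have "\<dots> \<subseteq> U" using pK[OF eq(2)] eq(3) by (simp add: \<gamma>2_def)
        finally show "{Inf (snd i)<..<Sup (snd i)} \<subseteq> U" using eq by simp
      qed
    qed (use fN in \<open>auto intro!: sets.finite_UN\<close>)
    finally have "(\<Sum>i\<in>pN. Sup (snd i) - Inf (snd i)) < d" using mU by simp
    then have bad: "(\<Sum>i\<in>pN. \<bar>f (Sup (snd i)) - f (Inf (snd i))\<bar>) < e"
      using pN by (intro dd[OF fN _ disj]) auto
    have "f b - f a = (\<Sum>(x,K)\<in>p. f (Sup K) - f (Inf K))"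
      using additive_tagged_division_1[OF ab, of p f] p(1) by (simp add: box_real)
    also have "\<dots> \<le> (\<Sum>(x,K)\<in>p. measure lborel K *\<^sub>R g0 x + e * measure lborel K + (if x \<in> N then \<bar>f (Sup K) - f (Inf K)\<bar> else 0))"
    proof (rule sum_mono, clarify)
      fix x K assume xK: "(x,K) \<in> p"
      note K = pK[OF xK]
      show "f (Sup K) - f (Inf K) \<le> measure lborel K *\<^sub>R g0 x + e * measure lborel K + (if x \<in> N then \<bar>f (Sup K) - f (Inf K)\<bar> else 0)"
      proof (cases "x \<in> N")
        case True
        have "0 \<le> e * measure lborel K" using e by simp
        then show ?thesis using True by (simp add: g0_def)
      next
        case False
        have "x \<in> {Inf K..Sup K}" using K by simp
        then have "f (Sup K) - f (Inf K) \<le> (g x + e) * (Sup K - Inf K)"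
          using K False by (intro \<delta>(2)) (auto simp: \<gamma>2_def)
        moreover have cK: "measure lborel K = Sup K - Inf K" using K by blast
        ultimately show ?thesis using False unfolding cK by (simp add: g0_def algebra_simps)
      qed
    qed
    also have "\<dots> = (\<Sum>(x,K)\<in>p. measure lborel K *\<^sub>R g0 x) + e * (\<Sum>(x,K)\<in>p. measure lborel K)
        + (\<Sum>(x,K)\<in>p. if x \<in> N then \<bar>f (Sup K) - f (Inf K)\<bar> else 0)"
      by (simp add: case_prod_beta sum.distrib sum_distrib_left)
    also have "(\<Sum>(x,K)\<in>p. if x \<in> N then \<bar>f (Sup K) - f (Inf K)\<bar> else 0) = (\<Sum>i\<in>pN. \<bar>f (Sup (snd i)) - f (Inf (snd i))\<bar>)"
      using sum.inter_filter[OF fp, of "\<lambda>i. \<bar>f (Sup (snd i)) - f (Inf (snd i))\<bar>" "\<lambda>i. fst i \<in> N"]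
      by (simp add: pN_def case_prod_beta)
    also have "(\<Sum>(x,K)\<in>p. measure lborel K) = b - a"
      using additive_content_tagged_division[OF p(1)] ab by simp
    finally show ?thesis using bad \<gamma>1(2)[OF p(1,2)] by (simp add: algebra_simps)
  qed
  show ?thesis
  proof (rule field_le_epsilon)
    fix e :: real assume "0 < e"
    then show "f b - f a \<le> integral {a..b} g + e"
      using key[of "e / (b - a + 2)"] ab by simp
  qed
qed

subsection \<open>Gronwall inequalities\<close>

text \<open>Over an equal subdivision finer than \<open>d\<close> the local inequalities telescope,
  and so does the error, to \<open>e * (G b - G a)\<close>, whatever the subdivision. Measuring the
  error by a fixed \<open>G\<close> accommodates indefinite integrals of unbounded
  functions.\<close>

lemma increment_le_of_local:
  fixes F G H :: "real \<Rightarrow> real"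
  assumes ab: "a \<le> b"
    and loc: "\<And>e. 0 < e \<Longrightarrow> \<exists>d>0. \<forall>u v. a \<le> u \<and> u \<le> v \<and> v \<le> b \<and> v - u < d
      \<longrightarrow> F v - F u \<le> H v - H u + e * (G v - G u)"
  shows "F b - F a \<le> H b - H a"
proof -
  have key: "F b - F a \<le> H b - H a + e * (G b - G a)" if "0 < e" for e
  proof -
    obtain d where d: "d > 0" and dd: "\<And>u v. a \<le> u \<Longrightarrow> u \<le> v \<Longrightarrow> v \<le> b \<Longrightarrow> v - u < d
      \<Longrightarrow> F v - F u \<le> H v - H u + e * (G v - G u)"
      using loc[OF \<open>0 < e\<close>] by blast
    obtain n where n: "(b - a) / d < real n" using reals_Archimedean2 by blast
    then have n0: "0 < real n" using ab d by (smt (verit) divide_nonneg_pos)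
    define x where "x i = a + real i * ((b - a) / real n)" for i
    have x: "x 0 = a" "x n = b" using n0 by (auto simp: x_def)
    define h where "h = (b - a) / real n"
    have h: "0 \<le> h" "h < d" using n n0 d ab by (auto simp: h_def field_simps)
    have step: "F (x (Suc i)) - F (x i) \<le> (H (x (Suc i)) - H (x i)) + e * (G (x (Suc i)) - G (x i))" if "i < n" for i
    proof (rule dd)
      have xs: "x (Suc i) = x i + h" by (simp add: x_def distrib_right flip: h_def)
      show "a \<le> x i" using h by (simp add: x_def flip: h_def)
      show "x i \<le> x (Suc i)" "x (Suc i) - x i < d" using h xs by auto
      have "real (Suc i) * h \<le> real n * h" using that h by (intro mult_right_mono) auto
      then show "x (Suc i) \<le> b" using n0 by (simp add: x_def h_def)
    qed
    have "F b - F a = (\<Sum>i<n. F (x (Suc i)) - F (x i))"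
      using sum_lessThan_telescope[of "\<lambda>i. F (x i)" n] x by simp
    also have "\<dots> \<le> (\<Sum>i<n. (H (x (Suc i)) - H (x i)) + e * (G (x (Suc i)) - G (x i)))"
      using step by (intro sum_mono) auto
    also have "\<dots> = H b - H a + e * (G b - G a)"
      using sum_lessThan_telescope[of "\<lambda>i. H (x i)" n] sum_lessThan_telescope[of "\<lambda>i. G (x i)" n] x
      by (simp add: sum.distrib sum_distrib_left[symmetric])
    finally show ?thesis .
  qed
  show ?thesis
  proof (rule field_le_epsilon)
    fix \<epsilon> :: real assume "0 < \<epsilon>"
    define e where "e = \<epsilon> / (\<bar>G b - G a\<bar> + 1)"
    have e: "0 < e" using \<open>0 < \<epsilon>\<close> by (simp add: e_def)
    have "e * (G b - G a) \<le> e * (\<bar>G b - G a\<bar> + 1)" using e by (intro mult_left_mono) auto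
    also have "\<dots> = \<epsilon>" by (simp add: e_def)
    finally show "F b - F a \<le> H b - H a + \<epsilon>" using key[OF e] by simp
  qed
qed

lemma integral_Icc_diff:
  fixes f :: "real \<Rightarrow> real"
  assumes "f integrable_on {a..b}" "a \<le> u" "u \<le> v" "v \<le> b"
  shows "integral {a..v} f - integral {a..u} f = integral {u..v} f"
proof -
  have "f integrable_on {a..v}" by (rule integrable_subinterval_real[OF assms(1)]) (use assms in auto)
  then show ?thesis using Henstock_Kurzweil_Integration.integral_combine[of a u v f] assms by simp
qed

text \<open>Serves the products with the running maximum, which enters as a bounded monotone, hence
  measurable, function.\<close>

lemma integrable_on_bounded_measurable_mult:
  fixes f h :: "real \<Rightarrow> real"
  assumes f: "f integrable_on {a..b}" and nn: "\<And>x. x \<in> {a..b} \<Longrightarrow> 0 \<le> f x"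
    and h: "h \<in> borel_measurable (lebesgue_on {a..b})" "bounded (h ` {a..b})"
  shows "(\<lambda>x. f x * h x) integrable_on {a..b}"
proof -
  have "f absolutely_integrable_on {a..b}" using f nn by (rule nonnegative_absolutely_integrable_1)
  then have "(\<lambda>x. h x * f x) absolutely_integrable_on {a..b}"
    using h by (intro absolutely_integrable_bounded_measurable_product_real) auto
  then show ?thesis using set_lebesgue_integral_eq_integral(1) by (simp add: mult.commute)
qed

lemma integrable_on_continuous_mult:
  fixes f h :: "real \<Rightarrow> real"
  assumes f: "f integrable_on {a..b}" and nn: "\<And>x. x \<in> {a..b} \<Longrightarrow> 0 \<le> f x"
    and h: "continuous_on {a..b} h"
  shows "(\<lambda>x. f x * h x) integrable_on {a..b}"
  using f nn
proof (rule integrable_on_bounded_measurable_mult)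
  show "h \<in> borel_measurable (lebesgue_on {a..b})"
    using h by (simp add: continuous_imp_measurable_on_sets_lebesgue)
  show "bounded (h ` {a..b})"
    using h by (simp add: compact_imp_bounded compact_continuous_image)
qed

lemma integral_Icc_nonneg_mono:
  fixes f :: "real \<Rightarrow> real"
  assumes "f integrable_on {a..b}" "\<And>x. x \<in> {a..b} \<Longrightarrow> 0 \<le> f x" "a \<le> u" "u \<le> v" "v \<le> b"
  shows "integral {a..u} f \<le> integral {a..v} f"
proof -
  have "0 \<le> integral {u..v} f" using assms by (intro integral_nonneg integrable_subinterval_real[OF assms(1)]) auto
  then show ?thesis using integral_Icc_diff[OF assms(1,3,4,5)] by simp
qed

text \<open>The majorant \<open>Y\<close> of \<open>y\<close> is continuous and nondecreasing, which
  \<open>y\<close> need not be. With the integrating factor \<open>exp (- W)\<close>, the increments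
  of \<open>Y * exp (- W)\<close> are at most those of the integral of \<open>w\<close>, up to
  \<open>e\<close> times an increment of \<open>W\<close>.\<close>

theorem Gronwall_linear:
  fixes \<alpha> \<beta> y :: "real \<Rightarrow> real"
  assumes ab: "a \<le> b" and nn: "\<And>t. t \<in> {a..b} \<Longrightarrow> 0 \<le> \<alpha> t \<and> 0 \<le> \<beta> t \<and> 0 \<le> y t" and y0: "0 \<le> y0"
    and int: "\<alpha> integrable_on {a..b}" "\<beta> integrable_on {a..b}" "(\<lambda>s. \<beta> s * y s) integrable_on {a..b}"
    and le: "\<And>t. t \<in> {a..b} \<Longrightarrow> y t \<le> y0 + integral {a..t} (\<lambda>s. \<alpha> s + \<beta> s * y s)"
  shows "y b \<le> y0 * exp (integral {a..b} \<beta>) + integral {a..b} (\<lambda>s. \<alpha> s * exp (integral {s..b} \<beta>))"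
proof -
  define W where "W t = integral {a..t} \<beta>" for t
  define Y where "Y t = y0 + integral {a..t} (\<lambda>s. \<alpha> s + \<beta> s * y s)" for t
  have intk: "(\<lambda>s. \<alpha> s + \<beta> s * y s) integrable_on {a..b}" using int by (intro integrable_add)
  have Wc: "continuous_on {a..b} W" unfolding W_def by (rule indefinite_integral_continuous_1[OF int(2)])
  have Yc: "continuous_on {a..b} Y" unfolding Y_def
    by (intro continuous_intros indefinite_integral_continuous_1[OF intk])
  have Wd: "W v - W u = integral {u..v} \<beta>" if "a \<le> u" "u \<le> v" "v \<le> b" for u v
    unfolding W_def by (rule integral_Icc_diff[OF int(2) that])
  have Wm: "W u \<le> W v" if "a \<le> u" "u \<le> v" "v \<le> b" for u v
    unfolding W_def using nn that by (intro integral_Icc_nonneg_mono[OF int(2)]) auto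
  have Ym: "Y u \<le> Y v" if "a \<le> u" "u \<le> v" "v \<le> b" for u v
    unfolding Y_def using nn that by (intro add_mono integral_Icc_nonneg_mono[OF intk]) auto
  have Ya: "Y a = y0" and Wa: "W a = 0" by (auto simp: Y_def W_def)
  define w where "w s = \<alpha> s * exp (- W s)" for s
  have wint: "w integrable_on {a..b}" unfolding w_def
    using int(1) nn by (intro integrable_on_continuous_mult continuous_intros Wc) auto
  have "Y b * exp (- W b) - Y a * exp (- W a) \<le> integral {a..b} w - integral {a..a} w"
  proof (rule increment_le_of_local[OF ab, where G=W])
    fix e :: real assume "0 < e"
    have "uniformly_continuous_on {a..b} Y" using Yc by (simp add: compact_uniformly_continuous)
    then obtain d where d: "d > 0" "\<And>u v. u \<in> {a..b} \<Longrightarrow> v \<in> {a..b} \<Longrightarrow> dist v u < d \<Longrightarrow> dist (Y v) (Y u) < e"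
      using \<open>0 < e\<close> unfolding uniformly_continuous_on_def by metis
    have "Y v * exp (- W v) - Y u * exp (- W u) \<le> integral {a..v} w - integral {a..u} w + e * (W v - W u)"
      if uv: "a \<le> u" "u \<le> v" "v \<le> b" "v - u < d" for u v
    proof -
      define D where "D = W v - W u"
      have sub: "f integrable_on {u..v}" if "f integrable_on {a..b}" for f :: "real \<Rightarrow> real"
        by (rule integrable_subinterval_real[OF that]) (use uv in auto)
      have D0: "0 \<le> D" using Wm uv by (simp add: D_def)
      have Yuv: "Y v - Y u < e" using d(2)[of u v] uv by (auto simp: dist_real_def)
      have Yu: "0 \<le> Y u" using Ym[of a u] Ya y0 uv by simp
      have "Y v - Y u = integral {u..v} (\<lambda>s. \<alpha> s + \<beta> s * y s)"
        unfolding Y_def using integral_Icc_diff[OF intk uv(1-3)] by simp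
      also have "\<dots> \<le> integral {u..v} (\<lambda>s. \<alpha> s + \<beta> s * Y v)"
      proof (rule integral_le)
        show "(\<lambda>s. \<alpha> s + \<beta> s * Y v) integrable_on {u..v}"
          using sub[OF int(1)] sub[OF int(2)] by (intro integrable_add integrable_on_mult_left)
        fix s assume s: "s \<in> {u..v}"
        then have "y s \<le> Y v" using le[of s] Ym[of s v] uv by (simp add: Y_def)
        then show "\<alpha> s + \<beta> s * y s \<le> \<alpha> s + \<beta> s * Y v"
          using nn[of s] s uv by (intro add_mono mult_left_mono) auto
      qed (rule sub[OF intk])
      also have "\<dots> = integral {u..v} \<alpha> + D * Y v"
        using sub[OF int(1)] sub[OF int(2)] Wd[OF uv(1-3)]
        by (simp add: integral_add integrable_on_mult_left D_def)
      finally have 1: "Y v - Y u \<le> integral {u..v} \<alpha> + D * Y v" .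
      \<comment> \<open>Bounding \<open>exp D\<close> below by \<open>1 + D\<close> replaces
        differentiation of the integrating factor. What is left over is
        \<open>D * (Y v - Y u)\<close>, which uniform continuity of \<open>Y\<close> bounds by
        \<open>D * e\<close>.\<close>
      have "exp (- W u) = exp (- W v) * exp D" by (simp add: D_def flip: exp_add)
      moreover have "1 + D \<le> exp D" by (rule exp_ge_add_one_self)
      ultimately have "Y u * (exp (- W v) * (1 + D)) \<le> Y u * exp (- W u)"
        using Yu by (intro mult_left_mono) auto
      then have "Y v * exp (- W v) - Y u * exp (- W u) \<le> exp (- W v) * (Y v - Y u - Y u * D)"
        by (simp add: algebra_simps)
      also have "\<dots> \<le> exp (- W v) * (integral {u..v} \<alpha> + D * (Y v - Y u))"
        using 1 by (intro mult_left_mono) (auto simp: algebra_simps)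
      also have "\<dots> = exp (- W v) * integral {u..v} \<alpha> + exp (- W v) * (D * (Y v - Y u))"
        by (simp add: algebra_simps)
      also have "exp (- W v) * (D * (Y v - Y u)) \<le> 1 * (D * e)"
      proof (intro mult_mono)
        show "exp (- W v) \<le> 1" using Wm[of a v] Wa uv by simp
      qed (use D0 Yuv Ym[of u v] uv in auto)
      also have "exp (- W v) * integral {u..v} \<alpha> = integral {u..v} (\<lambda>s. exp (- W v) * \<alpha> s)" by simp
      also have "\<dots> \<le> integral {u..v} w"
      proof (rule integral_le)
        show "(\<lambda>s. exp (- W v) * \<alpha> s) integrable_on {u..v}" using sub[OF int(1)] by (rule integrable_on_mult_right)
        fix s assume s: "s \<in> {u..v}"
        then have "exp (- W v) \<le> exp (- W s)" using Wm[of s v] uv by simp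
        then show "exp (- W v) * \<alpha> s \<le> w s"
          unfolding w_def using nn[of s] s uv by (subst mult.commute) (auto intro!: mult_left_mono)
      qed (rule sub[OF wint])
      also have "\<dots> = integral {a..v} w - integral {a..u} w" using integral_Icc_diff[OF wint uv(1-3)] by simp
      finally show ?thesis by (simp add: D_def mult.commute)
    qed
    then show "\<exists>d>0. \<forall>u v. a \<le> u \<and> u \<le> v \<and> v \<le> b \<and> v - u < d \<longrightarrow>
        Y v * exp (- W v) - Y u * exp (- W u) \<le> integral {a..v} w - integral {a..u} w + e * (W v - W u)"
      using d(1) by blast
  qed
  then have "Y b * exp (- W b) \<le> y0 + integral {a..b} w" by (simp add: Ya Wa)
  then have "Y b * exp (- W b) * exp (W b) \<le> (y0 + integral {a..b} w) * exp (W b)"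
    by (rule mult_right_mono) simp
  then have "Y b \<le> y0 * exp (W b) + integral {a..b} w * exp (W b)"
    by (simp add: algebra_simps flip: exp_add)
  also have "integral {a..b} w * exp (W b) = integral {a..b} (\<lambda>s. w s * exp (W b))" by simp
  also have "\<dots> = integral {a..b} (\<lambda>s. \<alpha> s * exp (integral {s..b} \<beta>))"
  proof (rule integral_cong)
    fix s assume "s \<in> {a..b}"
    then have "integral {s..b} \<beta> = W b - W s" using Wd[of s b] by simp
    then show "w s * exp (W b) = \<alpha> s * exp (integral {s..b} \<beta>)"
      by (simp add: w_def mult.assoc flip: exp_add)
  qed
  finally show ?thesis using le[of b] ab by (simp add: Y_def W_def)
qed

text \<open>Formally, \<open>2 * S * S' = R' \<le> \<kappa> * S + \<gamma> * S * S\<close>; dividing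
  by \<open>2 * S\<close> gives a linear inequality with halved coefficients, to which
  \<open>Gronwall_linear\<close> applies. The division needs \<open>S\<close> bounded away from
  zero, which \<open>0 < r0\<close> provides.\<close>

theorem Gronwall_sqrt:
  fixes \<kappa> \<gamma> m :: "real \<Rightarrow> real"
  assumes ab: "a \<le> b" and nn: "\<And>t. t \<in> {a..b} \<Longrightarrow> 0 \<le> \<kappa> t \<and> 0 \<le> \<gamma> t \<and> 0 \<le> m t" and r0: "0 < r0"
    and int: "\<kappa> integrable_on {a..b}" "\<gamma> integrable_on {a..b}"
    and intm: "(\<lambda>s. \<kappa> s * sqrt (m s) + \<gamma> s * m s) integrable_on {a..b}"
    and le: "\<And>t. t \<in> {a..b} \<Longrightarrow> m t \<le> r0 + integral {a..t} (\<lambda>s. \<kappa> s * sqrt (m s) + \<gamma> s * m s)"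
  shows "sqrt (m b) \<le> sqrt r0 * exp (integral {a..b} (\<lambda>s. \<gamma> s / 2))
    + integral {a..b} (\<lambda>s. \<kappa> s / 2 * exp (integral {s..b} (\<lambda>s. \<gamma> s / 2)))"
proof -
  define R where "R t = r0 + integral {a..t} (\<lambda>s. \<kappa> s * sqrt (m s) + \<gamma> s * m s)" for t
  define S where "S t = sqrt (R t)" for t
  have Rm: "R u \<le> R v" if "a \<le> u" "u \<le> v" "v \<le> b" for u v
    unfolding R_def using nn that by (intro add_mono integral_Icc_nonneg_mono[OF intm]) auto
  have Ra: "R a = r0" by (simp add: R_def)
  have R0: "r0 \<le> R t" if "t \<in> {a..b}" for t using Rm[of a t] Ra that by simp
  have Sm: "S u \<le> S v" if "a \<le> u" "u \<le> v" "v \<le> b" for u v using Rm[OF that] by (simp add: S_def)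
  have S0: "sqrt r0 \<le> S t" if "t \<in> {a..b}" for t using R0[OF that] by (simp add: S_def)
  have S2: "S t * S t = R t" if "t \<in> {a..b}" for t using R0[OF that] r0 by (simp add: S_def)
  have mS: "sqrt (m t) \<le> S t" if "t \<in> {a..b}" for t using le[OF that] by (simp add: S_def R_def)
  have r0': "0 < sqrt r0" using r0 by simp
  have Sc: "continuous_on {a..b} S" unfolding S_def R_def
    by (intro continuous_intros indefinite_integral_continuous_1[OF intm])
  define k where "k s = \<kappa> s + \<gamma> s * S s" for s
  have kint: "k integrable_on {a..b}" unfolding k_def
    using int nn Sc by (intro integrable_add integrable_on_continuous_mult) auto
  have Sle: "S t \<le> sqrt r0 + integral {a..t} (\<lambda>s. \<kappa> s / 2 + \<gamma> s / 2 * S s)" if t: "t \<in> {a..b}" for t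
  proof -
    have "a \<le> t" using t by simp
    define H where "H v = integral {a..v} k / 2" for v
    have "S t - S a \<le> H t - H a"
    proof (rule increment_le_of_local[OF \<open>a \<le> t\<close>, where G="\<lambda>v. integral {a..v} k"])
      fix e :: real assume e: "0 < e"
      have "uniformly_continuous_on {a..b} S" using Sc by (simp add: compact_uniformly_continuous)
      \<comment> \<open>This tolerance yields \<open>S v - S u \<le> 2 * e * (S v + S u)\<close>,
        that is, \<open>S v \<le> (1/2 + e) * (S v + S u)\<close>: the factor \<open>1/2\<close>
        from differentiating a square root, up to \<open>e\<close>.\<close>
      moreover have "0 < 4 * e * sqrt r0" using e r0' by simp
      ultimately obtain d where d: "d > 0" "\<And>u v. u \<in> {a..b} \<Longrightarrow> v \<in> {a..b} \<Longrightarrow> dist v u < d \<Longrightarrow> dist (S v) (S u) < 4 * e * sqrt r0"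
        unfolding uniformly_continuous_on_def by metis
      have "S v - S u \<le> H v - H u + e * (integral {a..v} k - integral {a..u} k)"
        if uv: "a \<le> u" "u \<le> v" "v \<le> t" "v - u < d" for u v
      proof -
        have vb: "v \<le> b" "u \<in> {a..b}" "v \<in> {a..b}" using uv t by auto
        have sub: "f integrable_on {u..v}" if "f integrable_on {a..b}" for f :: "real \<Rightarrow> real"
        by (rule integrable_subinterval_real[OF that]) (use uv vb in auto)
        define J where "J = integral {u..v} k"
        have J: "integral {a..v} k - integral {a..u} k = J"
          unfolding J_def by (rule integral_Icc_diff[OF kint uv(1,2) vb(1)])
        have Ss: "0 < S s" if "s \<in> {a..b}" for s using S0[OF that] r0' by linarith
        have J0: "0 \<le> J" unfolding J_def
        proof (rule integral_nonneg[OF sub[OF kint]])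
          fix s assume "s \<in> {u..v}"
          then have "s \<in> {a..b}" using uv vb by auto
          then show "0 \<le> k s" using nn[of s] Ss[of s] by (simp add: k_def)
        qed
        have "R v - R u = integral {u..v} (\<lambda>s. \<kappa> s * sqrt (m s) + \<gamma> s * m s)"
          unfolding R_def using integral_Icc_diff[OF intm uv(1,2) vb(1)] by simp
        also have "\<dots> \<le> integral {u..v} (\<lambda>s. S v * k s)"
        proof (rule integral_le[OF sub[OF intm]])
          show "(\<lambda>s. S v * k s) integrable_on {u..v}" using sub[OF kint] by (rule integrable_on_mult_right)
          fix s assume s: "s \<in> {u..v}"
          then have sab: "s \<in> {a..b}" using uv vb by auto
          have 1: "sqrt (m s) \<le> S s" "S s \<le> S v" using mS[OF sab] Sm[of s v] s uv vb by auto
          \<comment> \<open>Only one factor \<open>S s\<close> is replaced by \<open>S v\<close>.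
            The other stays inside \<open>k\<close>, so that the result is again an integral
            inequality for \<open>S\<close>.\<close>
          have "m s \<le> S s * S s" using le[OF sab] S2[OF sab] by (simp add: R_def)
          also have "\<dots> \<le> S v * S s" using 1 Ss[OF sab] by (intro mult_right_mono) auto
          finally have 2: "m s \<le> S v * S s" .
          have "\<kappa> s * sqrt (m s) + \<gamma> s * m s \<le> \<kappa> s * S v + \<gamma> s * (S v * S s)"
            using 1 2 nn[OF sab] by (intro add_mono mult_left_mono) auto
          then show "\<kappa> s * sqrt (m s) + \<gamma> s * m s \<le> S v * k s" by (simp add: k_def algebra_simps)
        qed
        also have "\<dots> = S v * J" by (simp add: J_def)
        finally have 1: "R v - R u \<le> S v * J" .
        \<comment> \<open>The difference of squares takes the place of the chain rule.\<close>
        have "(S v - S u) * (S v + S u) = R v - R u"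
          using S2[OF vb(2)] S2[OF vb(3)] by (simp add: algebra_simps)
        also note 1
        also have "S v * J \<le> ((1/2 + e) * J) * (S v + S u)"
        proof -
          have "S v - S u < 4 * e * sqrt r0" using d(2)[OF vb(2,3)] uv by (auto simp: dist_real_def)
          also have "\<dots> = 2 * e * (sqrt r0 + sqrt r0)" by simp
          also have "\<dots> \<le> 2 * e * (S v + S u)"
            using S0[OF vb(2)] S0[OF vb(3)] e by (intro mult_left_mono add_mono) auto
          finally have "S v \<le> (1/2 + e) * (S v + S u)" by (simp add: algebra_simps add_divide_distrib)
          then have "S v * J \<le> (1/2 + e) * (S v + S u) * J" using J0 by (rule mult_right_mono)
          then show ?thesis by (simp add: algebra_simps)
        qed
        finally have "S v - S u \<le> (1/2 + e) * J"
          using Ss[OF vb(2)] Ss[OF vb(3)] by (metis add_pos_pos mult_le_cancel_right_pos)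
        then show ?thesis using J by (simp add: H_def algebra_simps add_divide_distrib)
      qed
      then show "\<exists>d>0. \<forall>u v. a \<le> u \<and> u \<le> v \<and> v \<le> t \<and> v - u < d \<longrightarrow>
          S v - S u \<le> H v - H u + e * (integral {a..v} k - integral {a..u} k)"
        using d(1) by blast
    qed
    moreover have "H t = integral {a..t} (\<lambda>s. \<kappa> s / 2 + \<gamma> s / 2 * S s)"
    proof -
      have "H t = integral {a..t} (\<lambda>s. k s / 2)" by (simp add: H_def)
      also have "(\<lambda>s. k s / 2) = (\<lambda>s. \<kappa> s / 2 + \<gamma> s / 2 * S s)" by (simp add: k_def fun_eq_iff field_simps)
      finally show ?thesis .
    qed
    ultimately show ?thesis by (simp add: H_def S_def Ra)
  qed
  have "S b \<le> sqrt r0 * exp (integral {a..b} (\<lambda>s. \<gamma> s / 2))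
    + integral {a..b} (\<lambda>s. \<kappa> s / 2 * exp (integral {s..b} (\<lambda>s. \<gamma> s / 2)))"
  proof (rule Gronwall_linear[OF ab _ _ _ _ _ Sle])
    show "0 \<le> \<kappa> t / 2 \<and> 0 \<le> \<gamma> t / 2 \<and> 0 \<le> S t" if "t \<in> {a..b}" for t
      using nn[OF that] order_trans[OF less_imp_le[OF r0'] S0[OF that]] by auto
    show "(\<lambda>s. \<kappa> s / 2) integrable_on {a..b}" "(\<lambda>s. \<gamma> s / 2) integrable_on {a..b}"
      using int by (auto intro: integrable_on_divide)
    then show "(\<lambda>s. \<gamma> s / 2 * S s) integrable_on {a..b}"
      using nn Sc by (intro integrable_on_continuous_mult) auto
  qed (use r0 in auto)
  then show ?thesis using mS[of b] ab by simp
qed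

subsection \<open>The differential inequality\<close>

lemma exp_ennreal_ennreal: "0 \<le> x \<Longrightarrow> exp_ennreal (ennreal x) = ennreal (exp x)"
  by (simp add: exp_ennreal_def)

lemma nn_set_integral_eq_integral:
  fixes f :: "real \<Rightarrow> real"
  assumes "f integrable_on S" "\<And>x. x \<in> S \<Longrightarrow> 0 \<le> f x"
  shows "(\<integral>\<^sup>+x\<in>S. ennreal (f x) \<partial>lebesgue) = ennreal (integral S f)"
  using nn_integral_has_integral_lebesgue'[OF assms(2) integrable_integral[OF assms(1)]]
  by (simp add: nn_integral_completion)

text \<open>Superlevel sets are closed upwards, hence empty, everything, or a ray with or without
  its endpoint. Applied below to an indefinite integral that may become infinite.\<close>

lemma borel_measurable_mono_ennreal:
  fixes f :: "real \<Rightarrow> ennreal"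
  assumes "mono f"
  shows "f \<in> borel_measurable borel"
proof (rule borel_measurableI_greater)
  fix y
  define U where "U = {x. y < f x}"
  have up: "x' \<in> U" if "x \<in> U" "x \<le> x'" for x x'
    using that assms by (auto simp: U_def mono_def intro: less_le_trans)
  have "U \<in> sets borel"
  proof (cases "U = {} \<or> U = UNIV")
    case False
    then obtain z where "z \<notin> U" by auto
    have bdd: "bdd_below U"
      unfolding bdd_below_def using up \<open>z \<notin> U\<close> by (metis linear)
    have "U = {Inf U<..} \<union> (U \<inter> {Inf U})"
    proof (intro set_eqI iffI)
      show "x \<in> {Inf U<..} \<union> (U \<inter> {Inf U})" if "x \<in> U" for x
        using cInf_lower[OF that bdd] that by auto
      show "x \<in> U" if "x \<in> {Inf U<..} \<union> (U \<inter> {Inf U})" for x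
        using that False cInf_lessD[of U x] up by (auto intro: less_imp_le)
    qed
    moreover have "{Inf U<..} \<union> (U \<inter> {Inf U}) \<in> sets borel"
      by (cases "Inf U \<in> U") auto
    ultimately show ?thesis by metis
  qed auto
  then show "{x \<in> space borel. y < f x} \<in> sets borel" by (simp add: U_def)
qed

text \<open>Integrals take values in \<open>[0, \<infinity>]\<close> because integrability is
  assumed for the product of \<open>K3\<close> with the integral of \<open>K4\<close>, not for
  \<open>K4\<close> alone. The value of \<open>deriv \<rho>\<close> is arbitrary where
  \<open>\<rho>\<close> is not differentiable, but absolute continuity makes these points a null
  set.\<close>

theorem theorem3p2:
  fixes T0 T :: real
    and \<rho> \<epsilon> K1 K2 K3 K4 :: "real \<Rightarrow> real"
    and \<gamma> :: "real \<Rightarrow> ennreal"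
  assumes T0_less_T: "T0 < T"
    and rho_nonneg: "\<forall>t\<in>{T0..T}. 0 \<le> \<rho> t"
    and rho_ac: "abs_continuous_on_Icc T0 T \<rho>"
    and nonneg: "\<forall>t\<in>{T0..T}. 0 \<le> \<epsilon> t \<and> 0 \<le> K1 t \<and> 0 \<le> K2 t \<and> 0 \<le> K3 t \<and> 0 \<le> K4 t"
    and meas: "\<epsilon> \<in> borel_measurable (lebesgue_on {T0..T})"
      "K1 \<in> borel_measurable (lebesgue_on {T0..T})"
      "K2 \<in> borel_measurable (lebesgue_on {T0..T})"
      "K3 \<in> borel_measurable (lebesgue_on {T0..T})"
      "K4 \<in> borel_measurable (lebesgue_on {T0..T})"
    and int_eps: "integrable (lebesgue_on {T0..T}) \<epsilon>"
    and int_K1: "integrable (lebesgue_on {T0..T}) K1"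
    and int_K2: "integrable (lebesgue_on {T0..T}) K2"
    and int_K3_K4:
      "(\<integral>\<^sup>+t\<in>{T0..T}. (ennreal (K3 t) * (\<integral>\<^sup>+s\<in>{T0..t}. ennreal (K4 s) \<partial>lebesgue)) \<partial>lebesgue) < \<infinity>"
    and ineq: "AE t in lebesgue_on {T0..T}.
      ereal (deriv \<rho> t) \<le> enn2ereal
        (ennreal (\<epsilon> t) + ennreal (K1 t * sqrt (\<rho> t)) + ennreal (K2 t * \<rho> t)
          + ennreal (K3 t * sqrt (\<rho> t)) *
              (\<integral>\<^sup>+s\<in>{T0..t}. ennreal (K4 s * sqrt (\<rho> s)) \<partial>lebesgue))"
    and gamma: "\<forall>t\<in>{T0..T}. \<gamma> t =
      ennreal (K2 t) + ennreal (K3 t) * (\<integral>\<^sup>+s\<in>{T0..t}. ennreal (K4 s) \<partial>lebesgue)"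
  shows "(\<forall>t\<in>{T0..T}.
      ennreal (\<rho> t) \<le>
        ennreal (\<rho> T0) * exp_ennreal (\<integral>\<^sup>+s\<in>{T0..t}. (\<gamma> s + ennreal (K1 s)) \<partial>lebesgue)
        + (\<integral>\<^sup>+s\<in>{T0..t}. (ennreal (\<epsilon> s + K1 s) *
              exp_ennreal (\<integral>\<^sup>+\<tau>\<in>{s..t}. (\<gamma> \<tau> + ennreal (K1 \<tau>)) \<partial>lebesgue)) \<partial>lebesgue))
    \<and> ((\<forall>t\<in>{T0..T}. \<epsilon> t = 0) \<longrightarrow>
      (\<forall>t\<in>{T0..T}.
        ennreal (sqrt (\<rho> t)) \<le>
          ennreal (sqrt (\<rho> T0)) * exp_ennreal (ennreal (1/2) * (\<integral>\<^sup>+s\<in>{T0..t}. \<gamma> s \<partial>lebesgue))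
          + ennreal (1/2) * (\<integral>\<^sup>+s\<in>{T0..t}. (ennreal (K1 s) *
              exp_ennreal (ennreal (1/2) * (\<integral>\<^sup>+\<tau>\<in>{s..t}. \<gamma> \<tau> \<partial>lebesgue))) \<partial>lebesgue)))"
proof -

  \<comment> \<open>The coefficient \<open>\<gamma>\<close> and its finite version\<close>
  let ?I = "{T0..T}"
  define k4 where "k4 t = (\<integral>\<^sup>+s\<in>{T0..t}. ennreal (K4 s) \<partial>lebesgue)" for t
  \<comment> \<open>The domain of integration grows with \<open>t\<close>, so \<open>k4\<close> is
    monotone and therefore measurable, even with infinite values.\<close>
  have "mono k4" unfolding mono_def k4_def
    by (auto intro!: nn_integral_mono mult_left_mono simp: indicator_def)
  then have "k4 \<in> borel_measurable borel" by (rule borel_measurable_mono_ennreal)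
  then have k4m: "k4 \<in> borel_measurable (lebesgue_on ?I)"
    by (intro measurable_restrict_space1 measurable_completion) simp
  have \<gamma>_eq: "\<gamma> t = ennreal (K2 t) + ennreal (K3 t) * k4 t" if "t \<in> ?I" for t
    using gamma that by (simp add: k4_def)
  have \<gamma>m: "\<gamma> \<in> borel_measurable (lebesgue_on ?I)"
  proof (subst measurable_cong)
    show "\<gamma> t = ennreal (K2 t) + ennreal (K3 t) * k4 t" if "t \<in> space (lebesgue_on ?I)" for t
      using \<gamma>_eq that by (simp add: space_restrict_space)
    show "(\<lambda>t. ennreal (K2 t) + ennreal (K3 t) * k4 t) \<in> borel_measurable (lebesgue_on ?I)"
      using k4m meas by measurable
  qed
  \<comment> \<open>\<open>enn2real\<close> gives the default \<open>0\<close> where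
    \<open>\<gamma>\<close> is infinite; these points form a null set because
    \<open>\<gamma>\<close> has a finite integral.\<close>
  define g where "g t = enn2real (\<gamma> t)" for t
  have gm: "g \<in> borel_measurable (lebesgue_on ?I)" unfolding g_def using \<gamma>m by measurable
  have fin: "(\<integral>\<^sup>+t. \<gamma> t \<partial>lebesgue_on ?I) < \<infinity>"
  proof -
    have "(\<integral>\<^sup>+t. \<gamma> t \<partial>lebesgue_on ?I) = (\<integral>\<^sup>+t. ennreal (K2 t) + ennreal (K3 t) * k4 t \<partial>lebesgue_on ?I)"
      using \<gamma>_eq by (intro nn_integral_cong) (simp add: space_restrict_space)
    also have "\<dots> = (\<integral>\<^sup>+t. ennreal (K2 t) \<partial>lebesgue_on ?I) + (\<integral>\<^sup>+t. ennreal (K3 t) * k4 t \<partial>lebesgue_on ?I)"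
    proof (rule nn_integral_add)
      show "(\<lambda>t. ennreal (K2 t)) \<in> borel_measurable (lebesgue_on ?I)" using meas(3) by measurable
      show "(\<lambda>t. ennreal (K3 t) * k4 t) \<in> borel_measurable (lebesgue_on ?I)" using meas(4) k4m by measurable
    qed
    finally have "(\<integral>\<^sup>+t. \<gamma> t \<partial>lebesgue_on ?I)
      = (\<integral>\<^sup>+t. ennreal (K2 t) \<partial>lebesgue_on ?I) + (\<integral>\<^sup>+t. ennreal (K3 t) * k4 t \<partial>lebesgue_on ?I)" .
    moreover have "(\<integral>\<^sup>+t. ennreal (K3 t) * k4 t \<partial>lebesgue_on ?I) < \<infinity>"
      using int_K3_K4 by (simp add: nn_integral_restrict_space k4_def)
    moreover have "(\<integral>\<^sup>+t. ennreal (K2 t) \<partial>lebesgue_on ?I) < \<infinity>"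
    proof -
      have "(\<integral>\<^sup>+t. ennreal (K2 t) \<partial>lebesgue_on ?I) = (\<integral>\<^sup>+t. ennreal (norm (K2 t)) \<partial>lebesgue_on ?I)"
        using nonneg by (intro nn_integral_cong) (simp add: space_restrict_space)
      then show ?thesis using int_K2 by (simp add: integrable_iff_bounded)
    qed
    ultimately show ?thesis by simp
  qed
  then have "AE t in lebesgue_on ?I. \<gamma> t \<noteq> \<infinity>"
    using \<gamma>m by (intro nn_integral_noteq_infinite) auto
  then have \<gamma>g: "AE t in lebesgue_on ?I. \<gamma> t = ennreal (g t)"
    by (rule AE_mp) (simp add: g_def less_top)
  have "(\<integral>\<^sup>+t. ennreal (norm (g t)) \<partial>lebesgue_on ?I) = (\<integral>\<^sup>+t. \<gamma> t \<partial>lebesgue_on ?I)"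
    using \<gamma>g by (intro nn_integral_cong_AE) (auto simp: g_def)
  then have "integrable (lebesgue_on ?I) g" using gm fin by (simp add: integrable_iff_bounded)
  then have gi: "g integrable_on ?I" by (rule integrable_on_lebesgue_on) simp
  have ei: "\<epsilon> integrable_on ?I" and K1i: "K1 integrable_on ?I"
    using int_eps int_K1 by (auto intro: integrable_on_lebesgue_on)
  have nn: "0 \<le> \<epsilon> t" "0 \<le> K1 t" "0 \<le> K2 t" "0 \<le> K3 t" "0 \<le> K4 t" "0 \<le> g t" "0 \<le> \<rho> t" if "t \<in> ?I" for t
    using nonneg rho_nonneg that by (auto simp: g_def)
  have sub: "f integrable_on {u..v}" if "f integrable_on ?I" "T0 \<le> u" "v \<le> T" for f :: "real \<Rightarrow> real" and u v
    by (rule integrable_subinterval_real[OF that(1)]) (use that in auto)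

  \<comment> \<open>The running maximum and the majorant of the right-hand side\<close>
  define m where "m t = Sup (\<rho> ` {T0..max T0 (min t T)})" for t
  have \<rho>c: "continuous_on ?I \<rho>" using rho_ac by (rule abs_continuous_on_Icc_imp_continuous_on)
  have "bounded (\<rho> ` ?I)" using \<rho>c by (simp add: compact_imp_bounded compact_continuous_image)
  then obtain B where B: "\<And>t. t \<in> ?I \<Longrightarrow> \<rho> t \<le> B"
    by (metis abs_le_D1 bounded_real imageI)
  have bdd: "bdd_above (\<rho> ` {T0..max T0 (min t T)})" for t
    using B T0_less_T by (intro bdd_aboveI2[of _ _ B]) (auto simp: max_def min_def split: if_splits)
  have \<rho>m: "\<rho> s \<le> m t" if "T0 \<le> s" "s \<le> t" "t \<le> T" for s t
    unfolding m_def using that by (intro cSup_upper bdd) auto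
  \<comment> \<open>Clamping the argument to \<open>{T0..T}\<close> makes \<open>m\<close> monotone
    on the whole line, from which its measurability follows.\<close>
  have mm: "mono m" unfolding mono_def m_def
    by (intro allI impI cSup_subset_mono bdd image_mono) auto
  have m_le: "m t \<le> c" if "t \<in> ?I" "\<And>s. s \<in> {T0..t} \<Longrightarrow> \<rho> s \<le> c" for t c
    unfolding m_def using that by (intro cSup_least) auto
  have m0: "0 \<le> m t" if "t \<in> ?I" for t using \<rho>m[of t t] nn(7)[OF that] that by simp
  have mB: "m t \<le> B" if "t \<in> ?I" for t using that B by (intro m_le) auto
  have mmeas: "m \<in> borel_measurable (lebesgue_on ?I)"
    using borel_measurable_mono[OF mm] by (intro measurable_restrict_space1 measurable_completion) simp
  have mb: "bounded (m ` ?I)" unfolding bounded_iff using m0 mB by (intro exI[of _ B]) auto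
  have smb: "bounded ((\<lambda>t. sqrt (m t)) ` ?I)" unfolding bounded_iff using m0 mB by (intro exI[of _ "sqrt B"]) auto
  have gmi: "(\<lambda>t. g t * m t) integrable_on ?I" using gi nn mmeas mb by (intro integrable_on_bounded_measurable_mult) auto
  have Kmi: "(\<lambda>t. K1 t * m t) integrable_on ?I" using K1i nn mmeas mb by (intro integrable_on_bounded_measurable_mult) auto
  have Ksi: "(\<lambda>t. K1 t * sqrt (m t)) integrable_on ?I" using K1i nn mmeas smb by (intro integrable_on_bounded_measurable_mult) auto
  \<comment> \<open>A majorant of the right-hand side of the differential inequality, with
    \<open>m\<close> in place of \<open>\<rho>\<close> and the nonlocal term absorbed into
    \<open>g t * m t\<close>.\<close>
  define k where "k t = \<epsilon> t + (K1 t * sqrt (m t) + g t * m t)" for t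
  have ki: "k integrable_on ?I" unfolding k_def using ei Ksi gmi by (intro integrable_add)
  have k0: "0 \<le> k t" if "t \<in> ?I" for t using nn[OF that] m0[OF that] by (simp add: k_def)

  have bound: "ennreal (\<epsilon> t) + ennreal (K1 t * sqrt (\<rho> t)) + ennreal (K2 t * \<rho> t)
          + ennreal (K3 t * sqrt (\<rho> t)) * (\<integral>\<^sup>+s\<in>{T0..t}. ennreal (K4 s * sqrt (\<rho> s)) \<partial>lebesgue) \<le> ennreal (k t)"
    if t: "t \<in> ?I" and \<gamma>t: "\<gamma> t = ennreal (g t)" for t
  proof -
    have \<rho>t: "\<rho> t \<le> m t" using t by (intro \<rho>m) auto
    \<comment> \<open>\<open>K4\<close> is known to be measurable only on \<open>{T0..T}\<close>;
      indicators carry this to the line, so that the constant \<open>sqrt (m t)\<close> can be taken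
      out of the integral.\<close>
    have "(\<lambda>s. ennreal (K4 s) * indicator ?I s) \<in> borel_measurable lebesgue"
      using meas(5) by (subst borel_measurable_restrict_space_iff_ennreal[symmetric]) auto
    then have "(\<lambda>s. (ennreal (K4 s) * indicator ?I s) * indicator {T0..t} s) \<in> borel_measurable lebesgue"
      by (rule borel_measurable_times_ennreal) (intro borel_measurable_indicator, simp)
    also have "(\<lambda>s. (ennreal (K4 s) * indicator ?I s) * indicator {T0..t} s) = (\<lambda>s. ennreal (K4 s) * indicator {T0..t} s)"
      using t by (auto simp: fun_eq_iff indicator_def)
    finally have K4m: "(\<lambda>s. ennreal (K4 s) * indicator {T0..t} s) \<in> borel_measurable lebesgue" .
    have "(\<integral>\<^sup>+s\<in>{T0..t}. ennreal (K4 s * sqrt (\<rho> s)) \<partial>lebesgue)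
        \<le> (\<integral>\<^sup>+s. (ennreal (K4 s) * indicator {T0..t} s) * ennreal (sqrt (m t)) \<partial>lebesgue)"
    proof (rule nn_integral_mono)
      fix s
      show "ennreal (K4 s * sqrt (\<rho> s)) * indicator {T0..t} s \<le> (ennreal (K4 s) * indicator {T0..t} s) * ennreal (sqrt (m t))"
      proof (cases "s \<in> {T0..t}")
        case True
        then have "s \<in> ?I" "\<rho> s \<le> m t" using t \<rho>m by auto
        then have "K4 s * sqrt (\<rho> s) \<le> K4 s * sqrt (m t)" using nn(5) by (intro mult_left_mono) auto
        then show ?thesis using True nn(5)[OF \<open>s \<in> ?I\<close>] m0[OF t] by (simp add: ennreal_mult[symmetric] ennreal_leI)
      qed auto
    qed
    also have "\<dots> = k4 t * ennreal (sqrt (m t))" using K4m by (simp add: nn_integral_multc k4_def)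
    finally have 1: "(\<integral>\<^sup>+s\<in>{T0..t}. ennreal (K4 s * sqrt (\<rho> s)) \<partial>lebesgue) \<le> k4 t * ennreal (sqrt (m t))" .
    have "ennreal (\<epsilon> t) + ennreal (K1 t * sqrt (\<rho> t)) + ennreal (K2 t * \<rho> t)
          + ennreal (K3 t * sqrt (\<rho> t)) * (\<integral>\<^sup>+s\<in>{T0..t}. ennreal (K4 s * sqrt (\<rho> s)) \<partial>lebesgue)
      \<le> ennreal (\<epsilon> t) + ennreal (K1 t * sqrt (m t)) + ennreal (K2 t * m t)
          + ennreal (K3 t * sqrt (m t)) * (k4 t * ennreal (sqrt (m t)))"
      using nn[OF t] \<rho>t 1 by (intro add_mono mult_mono ennreal_leI mult_left_mono) auto
    \<comment> \<open>The two factors \<open>sqrt (m t)\<close>, one from the present and one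
      bounding the past, combine to \<open>m t\<close>, which turns the nonlocal term into a part of
      \<open>\<gamma> t * m t\<close>.\<close>
    also have "ennreal (K3 t * sqrt (m t)) * (k4 t * ennreal (sqrt (m t)))
        = ennreal (K3 t) * k4 t * (ennreal (sqrt (m t)) * ennreal (sqrt (m t)))"
      using nn(4)[OF t] m0[OF t] by (simp add: ennreal_mult mult_ac)
    also have "ennreal (sqrt (m t)) * ennreal (sqrt (m t)) = ennreal (m t)"
      using m0[OF t] by (simp add: ennreal_mult[symmetric])
    also have "ennreal (\<epsilon> t) + ennreal (K1 t * sqrt (m t)) + ennreal (K2 t * m t) + ennreal (K3 t) * k4 t * ennreal (m t)
        = ennreal (\<epsilon> t) + ennreal (K1 t * sqrt (m t)) + \<gamma> t * ennreal (m t)"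
      using nn(3)[OF t] m0[OF t] \<gamma>_eq[OF t] by (simp add: ennreal_mult distrib_right add.assoc)
    also have "\<dots> = ennreal (k t)"
      using nn[OF t] m0[OF t] by (simp add: \<gamma>t k_def ennreal_mult[symmetric] ennreal_plus[symmetric] add.assoc del: ennreal_plus)
    finally show ?thesis .
  qed

  \<comment> \<open>From the differential inequality to an integral inequality for the running
    maximum\<close>
  have "AE t in lebesgue. t \<in> ?I \<longrightarrow> deriv \<rho> t \<le> k t"
  proof -
    have "AE t in lebesgue_on ?I. t \<in> ?I \<longrightarrow> deriv \<rho> t \<le> k t"
      using ineq \<gamma>g
    proof eventually_elim
      case (elim t)
      show ?case
      proof
        assume t: "t \<in> ?I"
        have "ereal (deriv \<rho> t) \<le> enn2ereal (ennreal (k t))"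
          using elim(1) bound[OF t elim(2)] by (meson less_eq_ennreal.rep_eq order_trans)
        then show "deriv \<rho> t \<le> k t" using k0[OF t] by simp
      qed
    qed
    then show ?thesis by (simp add: AE_restrict_space_iff)
  qed
  then obtain N where N: "N \<in> null_sets lebesgue" "\<And>t. t \<in> ?I - N \<Longrightarrow> deriv \<rho> t \<le> k t"
    by (rule AE_E3) auto
  \<comment> \<open>The endpoints are added because differentiability was established on the open
    interval only.\<close>
  define N' where "N' = N \<union> {t\<in>{T0<..<T}. \<not> \<rho> differentiable (at t)} \<union> {T0, T}"
  have N': "negligible N'"
    using abs_continuous_differentiable_ae[OF rho_ac] N(1)
    by (auto simp: N'_def negligible_iff_null_sets[symmetric])
  have \<rho>k: "\<rho> t - \<rho> T0 \<le> integral {T0..t} k" if t: "t \<in> ?I" for t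
  proof (rule abs_continuous_increment_le_integral[OF _ _ _ N'])
    show "abs_continuous_on_Icc T0 t \<rho>" using t by (intro abs_continuous_on_Icc_subset[OF rho_ac]) auto
    show "T0 \<le> t" "k integrable_on {T0..t}" using t sub[OF ki] by auto
    fix x assume x: "x \<in> {T0..t} - N'"
    then have "x \<in> ?I - N" "\<rho> differentiable (at x)" using t by (auto simp: N'_def)
    then have "deriv \<rho> x \<le> k x" "(\<rho> has_real_derivative deriv \<rho> x) (at x within {T0..t})"
      using N(2) by (auto simp: DERIV_deriv_iff_real_differentiable intro: has_field_derivative_at_within)
    then show "\<exists>D\<le>k x. (\<rho> has_real_derivative D) (at x within {T0..t})" by blast
  qed
  \<comment> \<open>As \<open>k\<close> is nonnegative, the bound at an earlier time
    \<open>s\<close> is at most the bound at \<open>t\<close>, so it passes to the maximum.\<close>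
  have mk: "m t \<le> \<rho> T0 + integral {T0..t} k" if t: "t \<in> ?I" for t
  proof (rule m_le[OF t])
    fix s assume s: "s \<in> {T0..t}"
    have "integral {T0..s} k \<le> integral {T0..t} k"
      using s t k0 by (intro integral_Icc_nonneg_mono[OF ki]) auto
    then show "\<rho> s \<le> \<rho> T0 + integral {T0..t} k" using \<rho>k[of s] s t by auto
  qed

  \<comment> \<open>Integrals of \<open>\<gamma>\<close> as real integrals of
    \<open>g\<close>\<close>
  have "AE t in lebesgue. t \<in> ?I \<longrightarrow> \<gamma> t = ennreal (g t)"
    using \<gamma>g by (simp add: AE_restrict_space_iff)
  \<comment> \<open>\<open>h\<close> is \<open>K1\<close> in part (a) and zero in part (b).\<close>
  then have nnI: "(\<integral>\<^sup>+s\<in>{u..v}. (\<gamma> s + ennreal (h s)) \<partial>lebesgue) = ennreal (integral {u..v} (\<lambda>s. g s + h s))"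
    if "T0 \<le> u" "v \<le> T" "h integrable_on ?I" "\<And>t. t \<in> ?I \<Longrightarrow> 0 \<le> h t" for u v h
  proof -
    have "(\<integral>\<^sup>+s\<in>{u..v}. (\<gamma> s + ennreal (h s)) \<partial>lebesgue) = (\<integral>\<^sup>+s\<in>{u..v}. ennreal (g s + h s) \<partial>lebesgue)"
    proof (rule nn_integral_cong_AE)
      show "AE s in lebesgue. (\<gamma> s + ennreal (h s)) * indicator {u..v} s = ennreal (g s + h s) * indicator {u..v} s"
        using \<open>AE t in lebesgue. t \<in> ?I \<longrightarrow> \<gamma> t = ennreal (g t)\<close>
      proof eventually_elim
        case (elim s)
        show ?case
        proof (cases "s \<in> {u..v}")
          case True
          then have "s \<in> ?I" using that by auto
          then show ?thesis using elim nn(6) that(4) by (simp add: ennreal_plus)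
        qed auto
      qed
    qed
    also have "\<dots> = ennreal (integral {u..v} (\<lambda>s. g s + h s))"
      using that(1,2,4) nn(6)
      by (intro nn_set_integral_eq_integral sub[OF integrable_add[OF gi that(3)]] add_nonneg_nonneg) auto
    finally show ?thesis .
  qed

  \<comment> \<open>Part (a), by the linear Gronwall inequality\<close>
  have A: "ennreal (\<rho> t) \<le>
        ennreal (\<rho> T0) * exp_ennreal (\<integral>\<^sup>+s\<in>{T0..t}. (\<gamma> s + ennreal (K1 s)) \<partial>lebesgue)
        + (\<integral>\<^sup>+s\<in>{T0..t}. (ennreal (\<epsilon> s + K1 s) *
              exp_ennreal (\<integral>\<^sup>+\<tau>\<in>{s..t}. (\<gamma> \<tau> + ennreal (K1 \<tau>)) \<partial>lebesgue)) \<partial>lebesgue)"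
    if t: "t \<in> ?I" for t
  proof -
    define \<beta> where "\<beta> s = g s + K1 s" for s
    have \<beta>i: "\<beta> integrable_on ?I" unfolding \<beta>_def using gi K1i by (rule integrable_add)
    have \<beta>0: "0 \<le> \<beta> s" if "s \<in> ?I" for s using nn[OF that] by (simp add: \<beta>_def)
    have ex: "exp_ennreal (\<integral>\<^sup>+\<tau>\<in>{s..t}. (\<gamma> \<tau> + ennreal (K1 \<tau>)) \<partial>lebesgue) = ennreal (exp (integral {s..t} \<beta>))"
      if "s \<in> {T0..t}" for s
    proof -
      have "0 \<le> integral {s..t} \<beta>"
        using that t \<beta>0 by (intro integral_nonneg sub[OF \<beta>i]) auto
      then show ?thesis
        using nnI[of s t K1] that t K1i nn(2) by (simp add: exp_ennreal_ennreal \<beta>_def[abs_def])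
    qed
    define w where "w s = (\<epsilon> s + K1 s) * exp (integral {s..t} \<beta>)" for s
    have w0: "0 \<le> w s" if "s \<in> {T0..t}" for s using nn[of s] that t by (simp add: w_def)
    have wi: "w integrable_on {T0..t}" unfolding w_def using t nn
      by (intro integrable_on_continuous_mult continuous_intros indefinite_integral_continuous_1' sub[OF \<beta>i]
          sub[OF integrable_add[OF ei K1i]] add_nonneg_nonneg) auto
    have "(\<integral>\<^sup>+s\<in>{T0..t}. (ennreal (\<epsilon> s + K1 s) *
              exp_ennreal (\<integral>\<^sup>+\<tau>\<in>{s..t}. (\<gamma> \<tau> + ennreal (K1 \<tau>)) \<partial>lebesgue)) \<partial>lebesgue)
      = (\<integral>\<^sup>+s\<in>{T0..t}. ennreal (w s) \<partial>lebesgue)"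
    proof (rule nn_integral_cong)
      fix s
      show "(ennreal (\<epsilon> s + K1 s) * exp_ennreal (\<integral>\<^sup>+\<tau>\<in>{s..t}. (\<gamma> \<tau> + ennreal (K1 \<tau>)) \<partial>lebesgue)) * indicator {T0..t} s
        = ennreal (w s) * indicator {T0..t} s"
        using ex[of s] by (cases "s \<in> {T0..t}") (simp_all add: w_def ennreal_mult'')
    qed
    also have "\<dots> = ennreal (integral {T0..t} w)" using wi w0 by (rule nn_set_integral_eq_integral)
    finally have 1: "(\<integral>\<^sup>+s\<in>{T0..t}. (ennreal (\<epsilon> s + K1 s) *
              exp_ennreal (\<integral>\<^sup>+\<tau>\<in>{s..t}. (\<gamma> \<tau> + ennreal (K1 \<tau>)) \<partial>lebesgue)) \<partial>lebesgue)
      = ennreal (integral {T0..t} w)" .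
    have "m t \<le> \<rho> T0 * exp (integral {T0..t} \<beta>) + integral {T0..t} w"
      unfolding w_def
    proof (rule Gronwall_linear)
      show "T0 \<le> t" "0 \<le> \<rho> T0" using t nn(7)[of T0] by auto
      show "0 \<le> \<epsilon> s + K1 s \<and> 0 \<le> \<beta> s \<and> 0 \<le> m s" if "s \<in> {T0..t}" for s
        using that t nn[of s] m0[of s] \<beta>0[of s] by auto
      have \<beta>mi: "(\<lambda>s. \<beta> s * m s) integrable_on ?I" using integrable_add[OF gmi Kmi] by (simp add: \<beta>_def algebra_simps)
      show "(\<lambda>s. \<epsilon> s + K1 s) integrable_on {T0..t}" "\<beta> integrable_on {T0..t}" "(\<lambda>s. \<beta> s * m s) integrable_on {T0..t}"
        using t sub[OF integrable_add[OF ei K1i]] sub[OF \<beta>i] sub[OF \<beta>mi] by auto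
      fix s assume s: "s \<in> {T0..t}"
      then have sI: "s \<in> ?I" using t by auto
      have "integral {T0..s} k \<le> integral {T0..s} (\<lambda>s. (\<epsilon> s + K1 s) + \<beta> s * m s)"
      proof (rule integral_le)
        show "k integrable_on {T0..s}" "(\<lambda>s. (\<epsilon> s + K1 s) + \<beta> s * m s) integrable_on {T0..s}"
          using sI sub[OF integrable_add[OF integrable_add[OF ei K1i] \<beta>mi]] sub[OF ki] by auto
        fix r assume "r \<in> {T0..s}"
        then have r: "r \<in> ?I" using sI by auto
        \<comment> \<open>This splits \<open>K1 * sqrt m\<close> into \<open>K1 + K1 * m\<close>, so
          \<open>K1\<close> appears both next to \<open>\<epsilon>\<close> and in the
          exponent.\<close>
        have "sqrt (m r) \<le> 1 + m r"
        proof (rule real_le_lsqrt)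
          show "m r \<le> (1 + m r)\<^sup>2" using m0[OF r] by (simp add: power2_eq_square algebra_simps)
        qed (use m0[OF r] in auto)
        then have "K1 r * sqrt (m r) \<le> K1 r * (1 + m r)" using nn(2)[OF r] by (rule mult_left_mono)
        then show "k r \<le> (\<epsilon> r + K1 r) + \<beta> r * m r" by (simp add: k_def \<beta>_def algebra_simps)
      qed
      then show "m s \<le> \<rho> T0 + integral {T0..s} (\<lambda>s. (\<epsilon> s + K1 s) + \<beta> s * m s)" using mk[OF sI] by simp
    qed
    then have "\<rho> t \<le> \<rho> T0 * exp (integral {T0..t} \<beta>) + integral {T0..t} w" using \<rho>m[of t t] t by simp
    then have "ennreal (\<rho> t) \<le> ennreal (\<rho> T0 * exp (integral {T0..t} \<beta>) + integral {T0..t} w)" by (rule ennreal_leI)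
    also have "\<dots> = ennreal (\<rho> T0) * ennreal (exp (integral {T0..t} \<beta>)) + ennreal (integral {T0..t} w)"
      using nn(7)[of T0] T0_less_T integral_nonneg[OF wi w0] by (simp add: ennreal_plus ennreal_mult)
    finally show ?thesis using 1 ex[of T0] t by simp
  qed

  \<comment> \<open>Part (b), by the square root Gronwall inequality\<close>
  have B: "ennreal (sqrt (\<rho> t)) \<le>
          ennreal (sqrt (\<rho> T0)) * exp_ennreal (ennreal (1/2) * (\<integral>\<^sup>+s\<in>{T0..t}. \<gamma> s \<partial>lebesgue))
          + ennreal (1/2) * (\<integral>\<^sup>+s\<in>{T0..t}. (ennreal (K1 s) *
              exp_ennreal (ennreal (1/2) * (\<integral>\<^sup>+\<tau>\<in>{s..t}. \<gamma> \<tau> \<partial>lebesgue))) \<partial>lebesgue)"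
    if \<epsilon>0: "\<forall>t\<in>?I. \<epsilon> t = 0" and t: "t \<in> ?I" for t
  proof -
    define \<beta> where "\<beta> s = g s / 2" for s
    have \<beta>i: "\<beta> integrable_on ?I" unfolding \<beta>_def using gi by simp
    have \<beta>0: "0 \<le> \<beta> s" if "s \<in> ?I" for s using nn[OF that] by (simp add: \<beta>_def)
    have ex: "exp_ennreal (ennreal (1/2) * (\<integral>\<^sup>+\<tau>\<in>{s..t}. \<gamma> \<tau> \<partial>lebesgue)) = ennreal (exp (integral {s..t} \<beta>))"
      if "s \<in> {T0..t}" for s
    proof -
      have "0 \<le> integral {s..t} g" using that t nn(6) by (intro integral_nonneg sub[OF gi]) auto
      then show ?thesis
        using nnI[of s t "\<lambda>_. 0", OF _ _ integrable_0] that t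
        by (simp add: exp_ennreal_ennreal \<beta>_def[abs_def] ennreal_mult[symmetric] del: ennreal_half)
    qed
    define w where "w s = K1 s * exp (integral {s..t} \<beta>)" for s
    have w0: "0 \<le> w s" if "s \<in> {T0..t}" for s using nn[of s] that t by (simp add: w_def)
    have wi: "w integrable_on {T0..t}" unfolding w_def using t nn
      by (intro integrable_on_continuous_mult continuous_intros indefinite_integral_continuous_1' sub[OF \<beta>i] sub[OF K1i]) auto
    have "(\<integral>\<^sup>+s\<in>{T0..t}. (ennreal (K1 s) *
              exp_ennreal (ennreal (1/2) * (\<integral>\<^sup>+\<tau>\<in>{s..t}. \<gamma> \<tau> \<partial>lebesgue))) \<partial>lebesgue)
      = (\<integral>\<^sup>+s\<in>{T0..t}. ennreal (w s) \<partial>lebesgue)"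
    proof (rule nn_integral_cong)
      fix s
      show "(ennreal (K1 s) * exp_ennreal (ennreal (1/2) * (\<integral>\<^sup>+\<tau>\<in>{s..t}. \<gamma> \<tau> \<partial>lebesgue))) * indicator {T0..t} s
        = ennreal (w s) * indicator {T0..t} s"
        using ex[of s] by (cases "s \<in> {T0..t}") (simp_all add: w_def ennreal_mult'' del: ennreal_half)
    qed
    also have "\<dots> = ennreal (integral {T0..t} w)" using wi w0 by (rule nn_set_integral_eq_integral)
    finally have 1: "(\<integral>\<^sup>+s\<in>{T0..t}. (ennreal (K1 s) *
              exp_ennreal (ennreal (1/2) * (\<integral>\<^sup>+\<tau>\<in>{s..t}. \<gamma> \<tau> \<partial>lebesgue))) \<partial>lebesgue)
      = ennreal (integral {T0..t} w)" .
    define E where "E = exp (integral {T0..t} \<beta>)"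
    have E: "0 < E" by (simp add: E_def)
    \<comment> \<open>\<open>\<rho> T0\<close> may vanish, whereas \<open>Gronwall_sqrt\<close>
      needs a positive initial value; hence the shift by \<open>\<delta>\<close>.\<close>
    have \<delta>: "sqrt (\<rho> t) \<le> sqrt (\<rho> T0 + \<delta>) * E + integral {T0..t} w / 2" if \<delta>: "0 < \<delta>" for \<delta>
    proof -
      have "sqrt (m t) \<le> sqrt (\<rho> T0 + \<delta>) * exp (integral {T0..t} (\<lambda>s. g s / 2))
        + integral {T0..t} (\<lambda>s. K1 s / 2 * exp (integral {s..t} (\<lambda>s. g s / 2)))"
      proof (rule Gronwall_sqrt)
        show "T0 \<le> t" "0 < \<rho> T0 + \<delta>" using t nn(7)[of T0] \<delta> by auto
        show "0 \<le> K1 s \<and> 0 \<le> g s \<and> 0 \<le> m s" if "s \<in> {T0..t}" for s using that t nn[of s] m0[of s] by auto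
        show "K1 integrable_on {T0..t}" "g integrable_on {T0..t}"
          "(\<lambda>s. K1 s * sqrt (m s) + g s * m s) integrable_on {T0..t}"
          using t sub[OF integrable_add[OF Ksi gmi]] sub[OF K1i] sub[OF gi] by auto
        fix s assume "s \<in> {T0..t}"
        then have sI: "s \<in> ?I" using t by auto
        have "integral {T0..s} k = integral {T0..s} (\<lambda>s. K1 s * sqrt (m s) + g s * m s)"
          using sI \<epsilon>0 by (intro integral_cong) (auto simp: k_def)
        then show "m s \<le> \<rho> T0 + \<delta> + integral {T0..s} (\<lambda>s. K1 s * sqrt (m s) + g s * m s)"
          using mk[OF sI] \<delta> by simp
      qed
      also have "integral {T0..t} (\<lambda>s. K1 s / 2 * exp (integral {s..t} (\<lambda>s. g s / 2))) = integral {T0..t} (\<lambda>s. w s / 2)"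
        by (simp add: w_def \<beta>_def[abs_def])
      finally have "sqrt (m t) \<le> sqrt (\<rho> T0 + \<delta>) * E + integral {T0..t} w / 2"
        by (simp add: E_def \<beta>_def[abs_def])
      moreover have "sqrt (\<rho> t) \<le> sqrt (m t)" using \<rho>m[of t t] t by simp
      ultimately show ?thesis by linarith
    qed
    have "sqrt (\<rho> t) \<le> sqrt (\<rho> T0) * E + integral {T0..t} w / 2"
    proof (rule field_le_epsilon)
      fix e :: real assume e: "0 < e"
      \<comment> \<open>By subadditivity of the square root, the shift
        \<open>\<delta> = (e/E)\<^sup>2\<close> costs at most \<open>e/E\<close> before, and
        \<open>e\<close> after, multiplication by \<open>E\<close>.\<close>
      have "sqrt (\<rho> T0 + (e/E)\<^sup>2) \<le> sqrt (\<rho> T0) + e/E"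
        using sqrt_add_le_add_sqrt[of "\<rho> T0" "(e/E)\<^sup>2"] nn(7)[of T0] T0_less_T e E by simp
      then have "sqrt (\<rho> T0 + (e/E)\<^sup>2) * E \<le> (sqrt (\<rho> T0) + e/E) * E" using E by (intro mult_right_mono) auto
      then show "sqrt (\<rho> t) \<le> sqrt (\<rho> T0) * E + integral {T0..t} w / 2 + e"
        using \<delta>[of "(e/E)\<^sup>2"] e E by (simp add: algebra_simps)
    qed
    then have "ennreal (sqrt (\<rho> t)) \<le> ennreal (sqrt (\<rho> T0) * E + integral {T0..t} w / 2)" by (rule ennreal_leI)
    also have "\<dots> = ennreal (sqrt (\<rho> T0)) * ennreal E + ennreal (1/2) * ennreal (integral {T0..t} w)"
      using nn(7)[of T0] T0_less_T integral_nonneg[OF wi w0] E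
      by (simp add: ennreal_plus ennreal_mult[symmetric] del: ennreal_half)
    finally show ?thesis using 1 ex[of T0] t by (simp add: E_def del: ennreal_half)
  qed
  show ?thesis using A B by blast
qed

end
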